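(* There is an absolute constant $C>0$ such that for all real numbers $M\ge1$, $N\ge1$ and $x$ with $2\pi MN^2=x$, $$\left|Q(x)-\sum_{1\le n<N}\frac1n\sin\left(\frac xn\right)-\frac\pi2-\sum_{1\le m<M}\left(\frac{\pi}{2mx}\right)^{\frac14}\sin\left(\frac\pi4+2\sqrt{2\pi mx}\right)\right|\le C\left(N^{-1}\ln(x)+x^{-\frac12}N^{\frac12}\right).$$ Here $n$ and $m$ range over integers.
   Context: The Hardy-Littlewood function is $Q(x):=\sum_{n\ge1}\frac1n\sin\left(\frac xn\right)$. An empty sum equals $0$. $M$ and $N$ are not required to be integers. *)

theory Defs
  imports Complex_Main
begin

text \<open>The Hardy--Littlewood function; the summation index is shifted so that
  \<open>Suc n\<close> runs over the positive integers.\<close>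

definition HL_Q :: "real \<Rightarrow> real" where
  "HL_Q x = (\<Sum>n. 1 / real (Suc n) * sin (x / real (Suc n)))"

end

theory Submission
  imports Defs "HOL-Probability.Sinc_Integral"
begin

text \<open>
  The tail \<open>\<Sum>n\<ge>N. f n\<close> with \<open>f t = sin (x / t) / t\<close> is replaced by \<open>\<integral> f D\<close> over \<open>[N, B]\<close>, where \<open>D\<close> is the
  Dirichlet kernel with \<open>K\<close> frequencies. Integration by parts against the remainder of the Fourier
  series of the sawtooth shows that the cost is \<open>O(1/N)\<close> as soon as \<open>B\<close> and then \<open>K\<close> are large powers
  of \<open>x\<close>; this polynomial size is harmless, since \<open>K\<close> enters the final error only through \<open>ln K\<close>.

  Frequency \<open>0\<close> contributes a sine integral, hence \<open>\<pi>/2\<close>. Frequency \<open>m\<close> contributes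
  \<open>\<integral> sin (x/t \<plusminus> 2\<pi>mt) dt/t\<close>. The phase with the minus sign has no stationary point. The one with the
  plus sign is stationary at \<open>t = sqrt (x / (2\<pi>m))\<close>, which is beyond \<open>N\<close> exactly when \<open>m < M\<close>. In that
  case the substitution \<open>w = sqrt (2\<pi>mt) - sqrt (x/t)\<close> produces a Fresnel integral and the main term;
  the end point \<open>N\<close> costs \<open>O(1 / (N |m - M|))\<close>, and \<open>O(1 / sqrt (MN))\<close> for the at most two \<open>m\<close> with
  \<open>|m - M| < 1\<close>. Summation over \<open>m \<le> K\<close> gives the logarithm.
\<close>

text \<open>Cutting the frequencies off at a finite \<open>K\<close> keeps every exchange of sum and
  integral finite. The price is the sawtooth remainder, which cannot be uniformly small: next to the
  integers its absolute value stays close to 1/2, and only its mean over a period tends to 0. About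
  \<open>B\<close> periods each contribute such a mean times a bound for the derivative of
  \<open>f\<close>; hence \<open>K\<close> has to be chosen after \<open>B\<close>. The error term
  \<open>x powr (-1/2) * N powr (1/2)\<close> is the cost of a stationary point close to
  \<open>N\<close>. There the second derivative of the phase is of order \<open>M / N\<close>, so
  the phase is flat over a length of order \<open>sqrt (N / M)\<close>, and the amplitude
  \<open>1 / N\<close> leaves \<open>1 / sqrt (M * N)\<close>. The complete Fresnel integrals are
  obtained from an identity for a square. It leaves a sign open, which a crude numerical estimate
  settles.\<close>

section \<open>Integrals with monotone amplitude\<close>

text \<open>The second mean value theorem moves a monotone amplitude to the two end points, at the
  price of an unknown cut \<open>c\<close>. That is why \<open>F\<close> has to bound the integral
  over every subinterval, and where the factor 2 comes from.\<close>

lemma abs_integral_monotone_amplitude_le: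
  fixes f g :: "real \<Rightarrow> real"
  assumes ab: "a \<le> b" and f: "continuous_on {a..b} f"
    and g: "mono_on {a..b} g \<or> antimono_on {a..b} g"
    and G: "\<And>t. t \<in> {a..b} \<Longrightarrow> \<bar>g t\<bar> \<le> G"
    and F: "\<And>c d. a \<le> c \<Longrightarrow> c \<le> d \<Longrightarrow> d \<le> b \<Longrightarrow> \<bar>integral {c..d} f\<bar> \<le> F"
  shows "\<bar>integral {a..b} (\<lambda>t. g t * f t)\<bar> \<le> 2 * G * F"
proof -
  have int: "f integrable_on {a..b}"
    using f integrable_continuous_real by blast
  have key: "\<bar>integral {a..b} (\<lambda>t. h t * f t)\<bar> \<le> 2 * G * F"
    if h: "mono_on {a..b} h" and G: "\<And>t. t \<in> {a..b} \<Longrightarrow> \<bar>h t\<bar> \<le> G" for h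
  proof -
    have "h x \<le> h y" if "a \<le> x" "x \<le> y" "y \<le> b" for x y
      using h that by (auto simp: mono_on_def)
    then obtain c where c: "c \<in> {a..b}"
      "integral {a..b} (\<lambda>t. h t * f t) = h a * integral {a..c} f + h b * integral {c..b} f"
      using second_mean_value_theorem[OF int ab, of h] by blast
    have "\<bar>h a * integral {a..c} f\<bar> \<le> G * F" "\<bar>h b * integral {c..b} f\<bar> \<le> G * F"
      unfolding abs_mult using c(1) ab
      by (auto intro!: mult_mono G F order_trans[OF abs_ge_zero G])
    then show ?thesis
      unfolding c(2) by linarith
  qed
  show ?thesis
  proof (cases "mono_on {a..b} g")
    case True
    then show ?thesis using key G by blast
  next
    case False
    then have "mono_on {a..b} (\<lambda>t. - g t)"
      using g by (auto simp: monotone_on_def)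
    then have "\<bar>integral {a..b} (\<lambda>t. - g t * f t)\<bar> \<le> 2 * G * F"
      using key[of "\<lambda>t. - g t"] G by simp
    then show ?thesis by simp
  qed
qed

text \<open>First derivative test: \<open>sin (\<phi> t)\<close> is \<open>1 / \<phi>' t\<close>
  times a function with primitive \<open>- cos (\<phi> t)\<close>, whose integrals are at most 2.
  The amplitude lemma removes the monotone factor \<open>1 / \<phi>'\<close>, which gives
  \<open>4 / \<mu>\<close>, and in a second use the decreasing \<open>g\<close>, which costs another
  \<open>2 * g a\<close>.\<close>

lemma van_der_corput_sin:
  fixes \<phi> \<phi>' g :: "real \<Rightarrow> real"
  assumes ab: "a \<le> b"
    and der: "\<And>t. t \<in> {a..b} \<Longrightarrow> (\<phi> has_real_derivative \<phi>' t) (at t)"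
    and cont: "continuous_on {a..b} \<phi>'"
    and mono: "mono_on {a..b} \<phi>' \<or> antimono_on {a..b} \<phi>'"
    and \<mu>: "0 < \<mu>" "\<And>t. t \<in> {a..b} \<Longrightarrow> \<mu> \<le> \<phi>' t"
    and g: "antimono_on {a..b} g" "\<And>t. t \<in> {a..b} \<Longrightarrow> 0 \<le> g t"
  shows "\<bar>integral {a..b} (\<lambda>t. g t * sin (\<phi> t))\<bar> \<le> 8 * g a / \<mu>"
proof -
  have cont\<phi>: "continuous_on {a..b} \<phi>"
    by (meson DERIV_continuous_on DERIV_subset der subset_UNIV)
  have pos: "0 < \<phi>' t" if "t \<in> {a..b}" for t
    using \<mu> that by force
  have FTC: "integral {c..d} (\<lambda>t. \<phi>' t * sin (\<phi> t)) = cos (\<phi> c) - cos (\<phi> d)"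
    if "a \<le> c" "c \<le> d" "d \<le> b" for c d
  proof -
    have "(\<phi> has_real_derivative \<phi>' t) (at t within {c..d})" if "t \<in> {c..d}" for t
      using that \<open>a \<le> c\<close> \<open>d \<le> b\<close> by (intro has_field_derivative_at_within[OF der]) auto
    then have "((\<lambda>t. \<phi>' t * sin (\<phi> t)) has_integral (- cos (\<phi> d)) - (- cos (\<phi> c))) {c..d}"
      using that
      by (intro fundamental_theorem_of_calculus)
        (auto simp flip: has_real_derivative_iff_has_vector_derivative
          intro!: derivative_eq_intros)
    then show ?thesis by (simp add: has_integral_iff)
  qed
  have step: "\<bar>integral {c..d} (\<lambda>t. sin (\<phi> t))\<bar> \<le> 4 / \<mu>"
    if cd: "a \<le> c" "c \<le> d" "d \<le> b" for c d
  proof -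
    have sub: "{c..d} \<subseteq> {a..b}" using cd by auto
    have "\<bar>integral {c..d} (\<lambda>t. (1 / \<phi>' t) * (\<phi>' t * sin (\<phi> t)))\<bar> \<le> 2 * (1 / \<mu>) * 2"
    proof (rule abs_integral_monotone_amplitude_le)
      show "continuous_on {c..d} (\<lambda>t. \<phi>' t * sin (\<phi> t))"
        using continuous_on_subset[OF cont sub] continuous_on_subset[OF cont\<phi> sub]
        by (intro continuous_intros)
      show "mono_on {c..d} (\<lambda>t. 1 / \<phi>' t) \<or> antimono_on {c..d} (\<lambda>t. 1 / \<phi>' t)"
        using mono
      proof
        assume "mono_on {a..b} \<phi>'"
        then have "antimono_on {c..d} (\<lambda>t. 1 / \<phi>' t)"
          using pos sub cd by (auto simp: monotone_on_def intro!: divide_left_mono mult_pos_pos)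
        then show ?thesis ..
      next
        assume "antimono_on {a..b} \<phi>'"
        then have "mono_on {c..d} (\<lambda>t. 1 / \<phi>' t)"
          using pos sub cd by (auto simp: monotone_on_def intro!: divide_left_mono mult_pos_pos)
        then show ?thesis ..
      qed
      show "\<bar>1 / \<phi>' t\<bar> \<le> 1 / \<mu>" if "t \<in> {c..d}" for t
      proof -
        have "t \<in> {a..b}" using that sub by auto
        then show ?thesis
          using \<mu>(1) \<mu>(2)[of t] pos[of t] by (auto simp: abs_of_pos intro!: divide_left_mono)
      qed
      show "\<bar>integral {p..q} (\<lambda>t. \<phi>' t * sin (\<phi> t))\<bar> \<le> 2" if "c \<le> p" "p \<le> q" "q \<le> d" for p q
      proof -
        have "\<bar>cos (\<phi> p)\<bar> \<le> 1" "\<bar>cos (\<phi> q)\<bar> \<le> 1" by auto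
        then show ?thesis
          using FTC[of p q] that cd by linarith
      qed
    qed fact
    moreover have "integral {c..d} (\<lambda>t. (1 / \<phi>' t) * (\<phi>' t * sin (\<phi> t))) = integral {c..d} (\<lambda>t. sin (\<phi> t))"
    proof (rule integral_cong)
      fix t assume "t \<in> {c..d}"
      then have "\<phi>' t \<noteq> 0" using pos[of t] sub by auto
      then show "(1 / \<phi>' t) * (\<phi>' t * sin (\<phi> t)) = sin (\<phi> t)" by simp
    qed
    ultimately show ?thesis by simp
  qed
  have "\<bar>integral {a..b} (\<lambda>t. g t * sin (\<phi> t))\<bar> \<le> 2 * g a * (4 / \<mu>)"
  proof (rule abs_integral_monotone_amplitude_le)
    show "\<bar>g t\<bar> \<le> g a" if "t \<in> {a..b}" for t
      using g that by (auto simp: monotone_on_def)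
  qed (use ab step g cont\<phi> in \<open>auto intro!: continuous_intros\<close>)
  then show ?thesis by simp
qed

section \<open>The Dirichlet kernel and the sawtooth\<close>

definition dirichlet_kernel :: "nat \<Rightarrow> real \<Rightarrow> real" where
  "dirichlet_kernel K t = 1 + 2 * (\<Sum>m = 1..K. cos (2 * pi * real m * t))"

text \<open>On \<open>(0, 1)\<close> this is \<open>t - 1 / 2\<close> minus a partial sum of its
  Fourier series. The linear term is not reduced modulo 1: this makes the function a smooth
  primitive of \<open>dirichlet_kernel K\<close> on the whole line, and later uses shift the
  argument into \<open>[0, 1]\<close>. The end values -1/2 and 1/2 produce the half weights of the
  trapezoidal rule.\<close>

definition sawtooth_remainder :: "nat \<Rightarrow> real \<Rightarrow> real" where
  "sawtooth_remainder K t = t - 1 / 2 + (\<Sum>m = 1..K. sin (2 * pi * real m * t) / (pi * real m))"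

lemma sawtooth_remainder_0 [simp]: "sawtooth_remainder K 0 = - 1 / 2"
  by (simp add: sawtooth_remainder_def)

lemma sin_2pi_nat_mult [simp]: "sin (2 * pi * real m) = 0"
  using sin_npi[of "2 * m"] by (simp add: mult_ac)

lemma sawtooth_remainder_1 [simp]: "sawtooth_remainder K 1 = 1 / 2"
  by (simp add: sawtooth_remainder_def)

lemma has_real_derivative_sawtooth_remainder [derivative_intros]:
  assumes "(f has_real_derivative f') (at t within S)"
  shows "((\<lambda>t. sawtooth_remainder K (f t)) has_real_derivative dirichlet_kernel K (f t) * f') (at t within S)"
proof -
  have "(sawtooth_remainder K has_real_derivative dirichlet_kernel K u) (at u)" for u
    unfolding sawtooth_remainder_def dirichlet_kernel_def
    by (auto intro!: derivative_eq_intros sum.cong simp: sum_distrib_left)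
  then show ?thesis
    using DERIV_chain2[OF _ assms, of "sawtooth_remainder K"] by blast
qed

lemma continuous_on_sawtooth_remainder [continuous_intros]:
  "continuous_on S f \<Longrightarrow> continuous_on S (\<lambda>t::real. sawtooth_remainder K (f t))"
  unfolding sawtooth_remainder_def by (auto intro!: continuous_intros)

lemma continuous_on_dirichlet_kernel [continuous_intros]:
  "continuous_on S f \<Longrightarrow> continuous_on S (\<lambda>t::real. dirichlet_kernel K (f t))"
  unfolding dirichlet_kernel_def by (auto intro!: continuous_intros)

lemma dirichlet_kernel_minus_nat: "dirichlet_kernel K (t - real n) = dirichlet_kernel K t"
proof -
  have "cos (2 * pi * real m * (t - real n)) = cos (2 * pi * real m * t)" for m
  proof -
    have "2 * pi * real m * (t - real n) = 2 * pi * real m * t - 2 * pi * real (m * n)"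
      by (simp add: algebra_simps)
    moreover have "cos (2 * pi * real (m * n)) = 1"
      using cos_npi[of "2 * (m * n)"] by (simp add: mult_ac)
    ultimately show ?thesis
      by (simp add: cos_diff del: of_nat_mult)
  qed
  then show ?thesis by (simp add: dirichlet_kernel_def)
qed

lemma sawtooth_remainder_reflect: "sawtooth_remainder K (1 - t) = - sawtooth_remainder K t"
proof -
  have "sin (2 * pi * real m * (1 - t)) = - sin (2 * pi * real m * t)" for m
  proof -
    have "2 * pi * real m * (1 - t) = 2 * pi * real m - 2 * pi * real m * t"
      by (simp add: algebra_simps)
    moreover have "cos (2 * pi * real m) = 1"
      using cos_npi[of "2 * m"] by (simp add: mult_ac)
    ultimately show ?thesis by (simp add: sin_diff)
  qed
  then show ?thesis by (simp add: sawtooth_remainder_def sum_negf)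
qed

lemma dirichlet_kernel_mult_sin:
  "dirichlet_kernel K t * sin (pi * t) = sin ((2 * real K + 1) * pi * t)"
proof (induction K)
  case 0
  then show ?case by (simp add: dirichlet_kernel_def)
next
  case (Suc K)
  have "2 * cos (2 * pi * real (Suc K) * t) * sin (pi * t)
      = sin ((2 * real (Suc K) + 1) * pi * t) - sin ((2 * real K + 1) * pi * t)"
  proof -
    have *: "2 * cos y * sin z = sin (y + z) - sin (y - z)" for y z :: real
      by (simp add: sin_add sin_diff)
    have "2 * pi * real (Suc K) * t + pi * t = (2 * real (Suc K) + 1) * pi * t"
      "2 * pi * real (Suc K) * t - pi * t = (2 * real K + 1) * pi * t"
      by (simp_all add: algebra_simps)
    then show ?thesis unfolding * by simp
  qed
  then show ?case
    using Suc by (simp add: dirichlet_kernel_def algebra_simps)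
qed

section \<open>Size of the sawtooth remainder, pointwise and in the mean\<close>

text \<open>Adding the boundary term of one integration by parts of the Dirichlet kernel leaves a function
  whose derivative is dominated by that of \<open>- 1 / (\<omega> sin (\<pi> t))\<close>.\<close>

lemma abs_sawtooth_remainder_le_sin:
  assumes t: "0 < t" "t \<le> 1 / 2"
  shows "\<bar>sawtooth_remainder K t\<bar> \<le> 2 / ((2 * real K + 1) * pi * sin (pi * t))"
proof -
  define \<omega> where "\<omega> = (2 * real K + 1) * pi"
  have \<omega>: "\<omega> > 0" by (simp add: \<omega>_def add_nonneg_pos)
  define G where "G s = sawtooth_remainder K s + cos (\<omega> * s) / (\<omega> * sin (pi * s))" for s
  define G' where "G' s = - (cos (\<omega> * s) * pi * cos (pi * s) / (\<omega> * (sin (pi * s))\<^sup>2))" for s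
  have sinpos: "sin (pi * s) > 0" if "t \<le> s" "s \<le> 1 / 2" for s
    using that t by (intro sin_gt_zero) auto
  have derG: "(G has_real_derivative G' s) (at s)" if "t \<le> s" "s \<le> 1 / 2" for s
  proof -
    have "dirichlet_kernel K s = sin (\<omega> * s) / sin (pi * s)"
      using dirichlet_kernel_mult_sin[of K s] sinpos[OF that] by (simp add: \<omega>_def field_simps)
    then show ?thesis
      unfolding G_def[abs_def] G'_def using sinpos[OF that] \<omega>
      by (auto intro!: derivative_eq_intros simp: field_simps power2_eq_square)
  qed
  define U where "U s = 1 / (\<omega> * sin (pi * s))" for s
  define U' where "U' s = - (pi * cos (pi * s) / (\<omega> * (sin (pi * s))\<^sup>2))" for s
  have derU: "(U has_real_derivative U' s) (at s)" if "t \<le> s" "s \<le> 1 / 2" for s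
    unfolding U_def[abs_def] U'_def using sinpos[OF that] \<omega>
    by (auto intro!: derivative_eq_intros simp: field_simps power2_eq_square)
  have bnd: "\<bar>G' s\<bar> \<le> - U' s" if "t \<le> s" "s \<le> 1 / 2" for s
  proof -
    have "cos (pi * s) \<ge> 0"
      using that t by (intro cos_ge_zero) (auto intro: order_trans[of _ 0])
    then have p: "0 \<le> pi * cos (pi * s) / (\<omega> * (sin (pi * s))\<^sup>2)" using \<omega> by simp
    have "\<bar>G' s\<bar> = \<bar>cos (\<omega> * s)\<bar> * \<bar>pi * cos (pi * s) / (\<omega> * (sin (pi * s))\<^sup>2)\<bar>"
      by (simp add: G'_def abs_mult)
    also have "\<dots> = \<bar>cos (\<omega> * s)\<bar> * (pi * cos (pi * s) / (\<omega> * (sin (pi * s))\<^sup>2))"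
      by (simp only: abs_of_nonneg[OF p])
    also have "\<dots> \<le> 1 * (pi * cos (pi * s) / (\<omega> * (sin (pi * s))\<^sup>2))"
      by (intro mult_right_mono p) auto
    finally show ?thesis by (simp add: U'_def)
  qed
  \<comment> \<open>\<open>G + U\<close> and \<open>U - G\<close> both decrease on
    \<open>[t, 1/2]\<close>. Since \<open>G\<close> vanishes and \<open>U\<close> is nonnegative at
    \<open>1 / 2\<close>, this carries \<open>\<bar>G\<bar> \<le> U\<close> over to
    \<open>t\<close>.\<close>
  have "(\<lambda>s. G s + U s) (1 / 2) \<le> (\<lambda>s. G s + U s) t"
    using t(2) by (rule DERIV_nonpos_imp_nonincreasing)
      (use derG derU bnd in \<open>force intro: derivative_eq_intros exI[of _ "G' _ + U' _"]\<close>)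
  moreover have "(\<lambda>s. U s - G s) (1 / 2) \<le> (\<lambda>s. U s - G s) t"
    using t(2) by (rule DERIV_nonpos_imp_nonincreasing)
      (use derG derU bnd in \<open>force intro: derivative_eq_intros exI[of _ "U' _ - G' _"]\<close>)
  moreover have "G (1 / 2) = 0"
  proof -
    have "sawtooth_remainder K (1 / 2) = 0"
      using sawtooth_remainder_reflect[of K "1 / 2"] by simp
    moreover have "\<omega> * (1 / 2) = real K * pi + pi / 2" by (simp add: \<omega>_def algebra_simps)
    then have "cos (\<omega> * (1 / 2)) = 0" by (simp only: cos_add) simp
    ultimately show ?thesis by (simp add: G_def)
  qed
  moreover have "U (1 / 2) \<ge> 0" using \<omega> by (simp add: U_def)
  ultimately have "\<bar>G t\<bar> \<le> U t" by linarith
  moreover have "\<bar>cos (\<omega> * t) / (\<omega> * sin (pi * t))\<bar> \<le> U t"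
    using \<omega> sinpos[of t] t by (simp add: U_def abs_mult divide_right_mono)
  ultimately have "\<bar>sawtooth_remainder K t\<bar> \<le> 2 * U t" unfolding G_def by linarith
  then show ?thesis by (simp add: U_def \<omega>_def)
qed

text \<open>Concavity would give \<open>2 * t\<close>. The cubic Taylor bound on
  \<open>[0, 2]\<close> gives \<open>y / 3 \<le> sin y\<close>, and \<open>3 < pi\<close> turns this
  into the weaker bound, which is enough.\<close>

lemma sin_pi_mult_ge:
  fixes t :: real
  assumes "0 \<le> t" "t \<le> 1 / 2"
  shows "t \<le> sin (pi * t)"
proof -
  define y where "y = pi * t"
  have y: "0 \<le> y" "y \<le> 2"
  proof -
    show "0 \<le> y" using assms by (simp add: y_def)
    have "pi * t \<le> 4 * (1 / 2)" using assms pi_less_4 by (intro mult_mono) auto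
    then show "y \<le> 2" by (simp add: y_def)
  qed
  have "\<bar>sin y - y\<bar> \<le> y ^ 3 / 6"
    using Maclaurin_sin_bound[of y 3] y(1)
    by (simp add: numeral_3_eq_3 sin_coeff_def fact_numeral lessThan_Suc eval_nat_numeral)
  moreover have "y ^ 3 \<le> 4 * y"
    using y mult_right_mono[OF power_mono[OF y(2,1), of 2], of y] by (simp add: power3_eq_cube power2_eq_square)
  ultimately have "y / 3 \<le> sin y" by linarith
  moreover have "3 * t \<le> y" using assms pi_gt3 by (simp add: y_def mult_right_mono)
  ultimately show ?thesis by (simp add: y_def)
qed

text \<open>For \<open>real K * t \<le> 1\<close> every term of the sum is at most
  \<open>2 * t\<close>, which bounds the remainder by 3; beyond that the bound by
  \<open>1 / sin (pi * t)\<close> takes over. The form \<open>6 / (1 + real K * t)\<close> covers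
  both ranges and has an elementary primitive.\<close>

lemma abs_sawtooth_remainder_le_half:
  assumes K: "K \<ge> 1" and t: "0 \<le> t" "t \<le> 1 / 2"
  shows "\<bar>sawtooth_remainder K t\<bar> \<le> 6 / (1 + real K * t)"
proof (cases "real K * t \<le> 1")
  case True
  have "\<bar>\<Sum>m = 1..K. sin (2 * pi * real m * t) / (pi * real m)\<bar> \<le> (\<Sum>m = 1..K. 2 * t)"
  proof (rule order_trans[OF sum_abs], rule sum_mono)
    fix m assume "m \<in> {1..K}"
    then show "\<bar>sin (2 * pi * real m * t) / (pi * real m)\<bar> \<le> 2 * t"
      using abs_sin_x_le_abs_x[of "2 * pi * real m * t"] t by (simp add: abs_mult field_simps)
  qed
  also have "\<dots> = 2 * (real K * t)" by simp
  finally have "\<bar>sawtooth_remainder K t\<bar> \<le> 3"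
    unfolding sawtooth_remainder_def using True t by linarith
  also have "3 \<le> 6 / (1 + real K * t)"
    using True t K by (simp add: field_simps add_pos_nonneg)
  finally show ?thesis .
next
  case False
  then have t0: "0 < t" using t by (cases "t = 0") auto
  have singe: "t \<le> sin (pi * t)" using sin_pi_mult_ge t by blast
  have "(1 + real K * t) / 3 \<le> real K * t"
  proof -
    have "(1 + y) / 3 \<le> y" if "\<not> y \<le> 1" for y :: real using that by simp
    then show ?thesis using False by blast
  qed
  also have "\<dots> \<le> ((2 * real K + 1) * pi) * sin (pi * t)"
  proof (intro mult_mono)
    have "real K * 1 \<le> (2 * real K + 1) * pi" using pi_ge_two by (intro mult_mono) auto
    then show "real K \<le> (2 * real K + 1) * pi" by simp
  qed (use t singe in auto)
  finally have "(1 + real K * t) / 3 \<le> (2 * real K + 1) * pi * sin (pi * t)" .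
  then have "2 / ((2 * real K + 1) * pi * sin (pi * t)) \<le> 2 / ((1 + real K * t) / 3)"
    using False by (intro divide_left_mono) auto
  then show ?thesis
    using abs_sawtooth_remainder_le_sin[of t K] t t0 by simp
qed

text \<open>Reflection supplies the right half. Adding the two one-sided bounds avoids a case
  distinction under the integral.\<close>

lemma abs_sawtooth_remainder_le:
  assumes K: "K \<ge> 1" and t: "0 \<le> t" "t \<le> 1"
  shows "\<bar>sawtooth_remainder K t\<bar> \<le> 6 / (1 + real K * t) + 6 / (1 + real K * (1 - t))"
proof (cases "t \<le> 1 / 2")
  case True
  have "0 \<le> 6 / (1 + real K * (1 - t))" using t by simp
  then show ?thesis
    using abs_sawtooth_remainder_le_half[OF K, of t] True t by linarith
next
  case False
  have "0 \<le> 6 / (1 + real K * t)" using t by simp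
  moreover have "\<bar>sawtooth_remainder K t\<bar> = \<bar>sawtooth_remainder K (1 - t)\<bar>"
    by (simp add: sawtooth_remainder_reflect)
  ultimately show ?thesis
    using abs_sawtooth_remainder_le_half[OF K, of "1 - t"] False t by linarith
qed

lemma abs_sawtooth_remainder_le_12:
  assumes K: "K \<ge> 1" and t: "0 \<le> t" "t \<le> 1"
  shows "\<bar>sawtooth_remainder K t\<bar> \<le> 12"
proof -
  have "6 / (1 + real K * t) \<le> 6 / 1" "6 / (1 + real K * (1 - t)) \<le> 6 / 1"
    using t by (intro divide_left_mono; auto simp: add_pos_nonneg)+
  then show ?thesis using abs_sawtooth_remainder_le[OF assms] by linarith
qed

text \<open>Integrating the pointwise bound gives \<open>12 * ln (1 + K) / K\<close> for
  \<open>K\<close> frequencies. With \<open>K = k\<^sup>2\<close> the logarithm is at most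
  \<open>2 * k\<close> and a clean \<open>1 / k\<close> remains; this is why the number of
  frequencies is a square in the summation lemmas.\<close>

lemma integral_abs_sawtooth_remainder_le:
  assumes k: "k \<ge> 1"
  shows "integral {0..1} (\<lambda>t. \<bar>sawtooth_remainder (k\<^sup>2) t\<bar>) \<le> 24 / real k"
proof -
  define K where "K = k\<^sup>2"
  have K: "K \<ge> 1" using k by (simp add: K_def)
  let ?U = "\<lambda>t. 6 / (1 + real K * t) + 6 / (1 + real K * (1 - t))"
  let ?A = "\<lambda>t. 6 * ln (1 + real K * t) / real K - 6 * ln (1 + real K * (1 - t)) / real K"
  have "(?U has_integral ?A 1 - ?A 0) {0..1}"
  proof (rule fundamental_theorem_of_calculus)
    fix t :: real assume t: "t \<in> {0..1}"
    have "0 < 1 + real K * t" "0 < 1 + real K * (1 - t)"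
      using t by (auto intro!: add_pos_nonneg)
    then show "(?A has_vector_derivative ?U t) (at t within {0..1})"
      using K unfolding has_real_derivative_iff_has_vector_derivative[symmetric]
      by (auto intro!: derivative_eq_intros)
  qed simp
  then have U: "(?U has_integral 12 * ln (1 + real K) / real K) {0..1}" by simp
  have "integral {0..1} (\<lambda>t. \<bar>sawtooth_remainder K t\<bar>) \<le> integral {0..1} ?U"
    by (intro integral_le has_integral_integrable[OF U] integrable_continuous_real continuous_intros
        abs_sawtooth_remainder_le K) auto
  also have "\<dots> = 12 * ln (1 + real K) / real K" using U by (simp add: has_integral_iff)
  also have "\<dots> \<le> 12 * (2 * real k) / real K"
  proof -
    have "1 + real K \<le> (1 + real k)\<^sup>2" by (simp add: K_def power2_sum)
    then have "ln (1 + real K) \<le> ln ((1 + real k)\<^sup>2)" by (simp add: add_pos_nonneg)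
    also have "\<dots> = 2 * ln (1 + real k)" by (simp add: ln_realpow add_pos_nonneg)
    also have "\<dots> \<le> 2 * real k" using ln_add_one_self_le_self[of "real k"] by simp
    finally show ?thesis by (intro divide_right_mono mult_left_mono) auto
  qed
  also have "\<dots> = 24 / real k" using k by (simp add: K_def power2_eq_square)
  finally show ?thesis by (simp add: K_def)
qed

section \<open>Summation by the Dirichlet kernel\<close>

text \<open>Integration by parts with the sawtooth remainder shifted by \<open>n\<close>: only its
  mean absolute value meets \<open>f'\<close>. The left end \<open>a\<close> may be any point of the
  unit interval because the summation starts at a real \<open>N\<close>.\<close>

lemma integral_mult_dirichlet_kernel_unit:
  fixes f f' :: "real \<Rightarrow> real"
  assumes a: "real n \<le> a" "a \<le> real n + 1" and k: "k \<ge> 1"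
    and der: "\<And>t. t \<ge> a \<Longrightarrow> (f has_real_derivative f' t) (at t)"
    and cont: "continuous_on {a..} f'"
    and L: "\<And>t. t \<ge> a \<Longrightarrow> \<bar>f' t\<bar> \<le> L"
  shows "\<bar>integral {a..real n + 1} (\<lambda>t. f t * dirichlet_kernel (k\<^sup>2) t)
      - (f (real n + 1) / 2 - f a * sawtooth_remainder (k\<^sup>2) (a - real n))\<bar> \<le> 24 * L / real k"
proof -
  define b where "b = real n + 1"
  define R where "R t = sawtooth_remainder (k\<^sup>2) (t - real n)" for t
  define D where "D = dirichlet_kernel (k\<^sup>2)"
  have L0: "L \<ge> 0" using L[of a] by linarith
  have contf: "continuous_on {a..b} f"
    by (meson DERIV_continuous_on DERIV_subset der subset_UNIV atLeastAtMost_iff)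
  have contf': "continuous_on {a..b} f'"
    using cont continuous_on_subset by fastforce
  have contR: "continuous_on S R" for S
    unfolding R_def by (intro continuous_intros)
  have contD: "continuous_on S D" for S
    unfolding D_def by (intro continuous_intros)
  have "((\<lambda>t. f t * D t + f' t * R t) has_integral f b * R b - f a * R a) {a..b}"
  proof (rule fundamental_theorem_of_calculus)
    fix t assume t: "t \<in> {a..b}"
    have "(f has_real_derivative f' t) (at t within {a..b})"
      using t by (intro has_field_derivative_at_within[OF der]) auto
    then show "((\<lambda>t. f t * R t) has_vector_derivative f t * D t + f' t * R t) (at t within {a..b})"
      unfolding has_real_derivative_iff_has_vector_derivative[symmetric] R_def D_def
      by (auto intro!: derivative_eq_intros simp: dirichlet_kernel_minus_nat)
  qed (use a in \<open>simp add: b_def\<close>)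
  moreover have "(\<lambda>t. f t * D t) integrable_on {a..b}" "(\<lambda>t. f' t * R t) integrable_on {a..b}"
    by (intro integrable_continuous_real continuous_intros contf contf' contR contD)+
  ultimately have "integral {a..b} (\<lambda>t. f t * D t) + integral {a..b} (\<lambda>t. f' t * R t) = f b * R b - f a * R a"
    by (metis integral_add integral_unique)
  moreover have "R b = 1 / 2" by (simp add: R_def b_def)
  moreover have "\<bar>integral {a..b} (\<lambda>t. f' t * R t)\<bar> \<le> L * (24 / real k)"
  proof -
    have "norm (integral {a..b} (\<lambda>t. f' t * R t)) \<le> integral {a..b} (\<lambda>t. L * \<bar>R t\<bar>)"
      using L by (intro integral_norm_bound_integral integrable_continuous_real continuous_intros contf' contR)
        (auto simp: abs_mult intro!: mult_right_mono)
    also have "\<dots> \<le> integral {real n..b} (\<lambda>t. L * \<bar>R t\<bar>)"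
      using a L0 by (intro integral_subset_le integrable_continuous_real continuous_intros contR) auto
    also have "\<dots> = L * integral {0 + real n..1 + real n} (\<lambda>t. \<bar>R t\<bar>)"
      by (simp add: b_def add.commute)
    also have "integral {0 + real n..1 + real n} (\<lambda>t. \<bar>R t\<bar>) = integral {0..1} ((\<lambda>t. \<bar>R t\<bar>) \<circ> (\<lambda>t. t + real n))"
      by (rule integral_shift[symmetric]) (intro continuous_intros contR)
    also have "\<dots> = integral {0..1} (\<lambda>t. \<bar>sawtooth_remainder (k\<^sup>2) t\<bar>)"
      by (simp add: R_def o_def)
    also have "L * \<dots> \<le> L * (24 / real k)"
      by (intro mult_left_mono integral_abs_sawtooth_remainder_le k L0)
    finally show ?thesis by simp
  qed
  ultimately show ?thesis
    unfolding b_def[symmetric] D_def[symmetric] R_def by (simp add: mult.commute)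
qed

text \<open>Each inner integer receives half of its value from either side.\<close>

lemma sum_minus_integral_dirichlet_kernel_nat:
  fixes f f' :: "real \<Rightarrow> real"
  assumes k: "k \<ge> 1"
    and der: "\<And>t. t \<ge> real p \<Longrightarrow> (f has_real_derivative f' t) (at t)"
    and cont: "continuous_on {real p..} f'"
    and L: "\<And>t. t \<ge> real p \<Longrightarrow> \<bar>f' t\<bar> \<le> L"
  shows "\<bar>(\<Sum>n = p..p + d. f (real n)) - (f (real p) + f (real (p + d))) / 2
      - integral {real p..real (p + d)} (\<lambda>t. f t * dirichlet_kernel (k\<^sup>2) t)\<bar> \<le> real d * (24 * L / real k)"
proof (induction d)
  case 0
  then show ?case by simp
next
  case (Suc d)
  let ?q = "p + d"
  let ?D = "\<lambda>t. f t * dirichlet_kernel (k\<^sup>2) t"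
  have "\<bar>integral {real ?q..real ?q + 1} ?D
      - (f (real ?q + 1) / 2 - f (real ?q) * sawtooth_remainder (k\<^sup>2) (real ?q - real ?q))\<bar> \<le> 24 * L / real k"
    by (rule integral_mult_dirichlet_kernel_unit[where f' = f'])
      (use k der L in \<open>auto intro: continuous_on_subset[OF cont]\<close>)
  then have 1: "\<bar>integral {real ?q..real (Suc ?q)} ?D - (f (real (Suc ?q)) + f (real ?q)) / 2\<bar> \<le> 24 * L / real k"
    by (simp add: add_divide_distrib add.commute)
  have contf: "continuous_on {real p..real (Suc ?q)} f"
    by (meson DERIV_continuous_on DERIV_subset der subset_UNIV atLeastAtMost_iff)
  have 2: "integral {real p..real ?q} ?D + integral {real ?q..real (Suc ?q)} ?D = integral {real p..real (Suc ?q)} ?D"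
    by (intro Henstock_Kurzweil_Integration.integral_combine integrable_continuous_real continuous_intros contf) auto
  have 3: "(\<Sum>n = p..Suc ?q. f (real n)) = (\<Sum>n = p..?q. f (real n)) + f (real (Suc ?q))"
    by simp
  have 4: "real (Suc d) * (24 * L / real k) = real d * (24 * L / real k) + 24 * L / real k"
    by (simp add: distrib_right add_divide_distrib)
  show ?case
    unfolding add_Suc_right 2[symmetric] 3 4 using Suc 1 unfolding add_divide_distrib by linarith
qed

text \<open>The incomplete interval from \<open>N\<close> to the first integer \<open>p\<close>
  supplies the half of \<open>f (real p)\<close> that the trapezoidal sum lacks, so boundary terms
  remain only at \<open>N\<close> and \<open>B\<close>. The 12 is the crude bound for the sawtooth
  remainder at \<open>N\<close>.\<close>

lemma sum_minus_integral_dirichlet_kernel: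
  fixes f f' :: "real \<Rightarrow> real"
  assumes k: "k \<ge> 1" and N: "1 \<le> N" "N \<le> real B"
    and der: "\<And>t. t \<ge> N \<Longrightarrow> (f has_real_derivative f' t) (at t)"
    and cont: "continuous_on {N..} f'"
    and L: "\<And>t. t \<ge> N \<Longrightarrow> \<bar>f' t\<bar> \<le> L"
  shows "\<bar>(\<Sum>n | N \<le> real n \<and> n \<le> B. f (real n)) - integral {N..real B} (\<lambda>t. f t * dirichlet_kernel (k\<^sup>2) t)\<bar>
      \<le> \<bar>f (real B)\<bar> + 12 * \<bar>f N\<bar> + real (B + 1) * (24 * L / real k)"
proof -
  let ?D = "\<lambda>t. f t * dirichlet_kernel (k\<^sup>2) t"
  define p where "p = nat \<lceil>N\<rceil>"
  \<comment> \<open>If \<open>N\<close> is an integer then \<open>p = N\<close>, and the piece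
    \<open>{N..real p}\<close> degenerates to the right end of the unit interval that starts at
    \<open>n\<close>.\<close>
  define n where "n = p - 1"
  have p: "N \<le> real p" "real p < N + 1" "p \<ge> 1" "p \<le> B"
    unfolding p_def using N by linarith+
  have n: "real n + 1 = real p" "real n \<le> N" "N \<le> real n + 1"
    using p by (auto simp: n_def of_nat_diff)
  have 1: "\<bar>integral {N..real p} ?D - (f (real p) / 2 - f N * sawtooth_remainder (k\<^sup>2) (N - real n))\<bar> \<le> 24 * L / real k"
    using integral_mult_dirichlet_kernel_unit[OF n(2,3) k der cont L] unfolding n(1) by blast
  have 2: "\<bar>(\<Sum>n = p..B. f (real n)) - (f (real p) + f (real B)) / 2 - integral {real p..real B} ?D\<bar>
      \<le> real (B - p) * (24 * L / real k)"
    using sum_minus_integral_dirichlet_kernel_nat[OF k, of p f f' L "B - p"] p der L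
      continuous_on_subset[OF cont, of "{real p..}"] by auto
  have "continuous_on {N..real B} f"
    by (meson DERIV_continuous_on DERIV_subset der subset_UNIV atLeastAtMost_iff)
  then have 3: "integral {N..real p} ?D + integral {real p..real B} ?D = integral {N..real B} ?D"
    by (intro Henstock_Kurzweil_Integration.integral_combine integrable_continuous_real continuous_intros) (use p in auto)
  have 4: "\<bar>f N * sawtooth_remainder (k\<^sup>2) (N - real n)\<bar> \<le> \<bar>f N\<bar> * 12"
    unfolding abs_mult using k n by (intro mult_left_mono abs_sawtooth_remainder_le_12) auto
  have 5: "{n. N \<le> real n \<and> n \<le> B} = {p..B}"
    unfolding p_def by (auto simp: nat_le_iff ceiling_le_iff)
  have "L \<ge> 0" using L[of N] by linarith
  then have 6: "real (B - p) * (24 * L / real k) + 24 * L / real k \<le> real (B + 1) * (24 * L / real k)"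
    using mult_right_mono[of "real (B - p) + 1" "real (B + 1)" "24 * L / real k"] k by (simp add: distrib_right add_divide_distrib)
  show ?thesis
    unfolding 5 3[symmetric] using 1 2 4 6 unfolding add_divide_distrib by linarith
qed

section \<open>Fresnel integrals\<close>

text \<open>The phase shift lets one function serve for both classical integrals:
  \<open>fresnel 0\<close> integrates \<open>sin (v\<^sup>2)\<close>,
  \<open>fresnel (pi / 2)\<close> integrates \<open>cos (v\<^sup>2)\<close>. In stationary phase,
  \<theta> is the value of the phase at the stationary point.\<close>

definition fresnel :: "real \<Rightarrow> real \<Rightarrow> real" where
  "fresnel \<theta> t = integral {0..t} (\<lambda>v. sin (\<theta> + v\<^sup>2))"

lemma fresnel_0 [simp]: "fresnel \<theta> 0 = 0"
  by (simp add: fresnel_def)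

lemma fresnel_sin_cos: "fresnel \<theta> t = sin \<theta> * fresnel (pi / 2) t + cos \<theta> * fresnel 0 t"
proof -
  have "fresnel \<theta> t = integral {0..t} (\<lambda>v. sin \<theta> * cos (v\<^sup>2) + cos \<theta> * sin (v\<^sup>2))"
    by (simp add: fresnel_def sin_add)
  also have "\<dots> = integral {0..t} (\<lambda>v. sin \<theta> * cos (v\<^sup>2)) + integral {0..t} (\<lambda>v. cos \<theta> * sin (v\<^sup>2))"
    by (intro integral_add integrable_continuous_real continuous_intros)
  finally show ?thesis by (simp add: fresnel_def sin_add)
qed

lemma fresnel_diff:
  assumes "0 \<le> s" "s \<le> t"
  shows "fresnel \<theta> t - fresnel \<theta> s = integral {s..t} (\<lambda>v. sin (\<theta> + v\<^sup>2))"
proof -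
  have "(\<lambda>v. sin (\<theta> + v\<^sup>2)) integrable_on {0..t}"
    by (intro integrable_continuous_real continuous_intros)
  from Henstock_Kurzweil_Integration.integral_combine[OF assms this] show ?thesis
    by (simp add: fresnel_def)
qed

lemma abs_fresnel_diff_le:
  assumes "0 < s" "s \<le> t"
  shows "\<bar>fresnel \<theta> t - fresnel \<theta> s\<bar> \<le> 4 / s"
proof -
  have "\<bar>integral {s..t} (\<lambda>v. 1 * sin (\<theta> + v\<^sup>2))\<bar> \<le> 8 * 1 / (2 * s)"
    by (rule van_der_corput_sin[where \<phi>' = "\<lambda>v. 2 * v" and g = "\<lambda>v. 1"])
      (use assms in \<open>auto intro!: derivative_eq_intros continuous_intros simp: monotone_on_def\<close>)
  then show ?thesis using assms by (simp add: fresnel_diff)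
qed

lemma abs_fresnel_diff_le_length:
  assumes "0 \<le> s" "s \<le> t"
  shows "\<bar>fresnel \<theta> t - fresnel \<theta> s\<bar> \<le> t - s"
proof -
  have "norm (integral {s..t} (\<lambda>v. sin (\<theta> + v\<^sup>2))) \<le> 1 * (t - s)"
    using assms by (intro integral_bound continuous_intros) auto
  then show ?thesis using assms by (simp add: fresnel_diff)
qed

lemma has_real_derivative_fresnel:
  assumes "t \<in> {0..T}"
  shows "(fresnel \<theta> has_real_derivative sin (\<theta> + t\<^sup>2)) (at t within {0..T})"
  unfolding fresnel_def[abs_def]
  by (rule integral_has_real_derivative) (use assms in \<open>auto intro!: continuous_intros\<close>)

section \<open>Evaluation of the complete Fresnel integrals\<close>

text \<open>With \<open>C = fresnel (\<pi>/2)\<close> and \<open>S = fresnel 0\<close> the left-hand side is the real part of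
  \<open>exp (i \<theta>) ((C + i S)\<^sup>2 - i \<pi>/4)\<close>; both sides have the same derivative in \<open>t\<close>.\<close>

lemma fresnel_square_eq:
  assumes "0 \<le> t"
  shows "cos \<theta> * ((fresnel (pi / 2) t)\<^sup>2 - (fresnel 0 t)\<^sup>2) - 2 * sin \<theta> * fresnel (pi / 2) t * fresnel 0 t
      + pi / 4 * sin \<theta> = integral {0..1} (\<lambda>y. sin (\<theta> + t\<^sup>2 * (1 + y\<^sup>2)) / (1 + y\<^sup>2))"
proof -
  define C where "C = fresnel (pi / 2)"
  define S where "S = fresnel 0"
  define H where "H s = integral (cbox 0 1) (\<lambda>y. sin (\<theta> + s\<^sup>2 * (1 + y\<^sup>2)) / (1 + y\<^sup>2))" for s
  define \<Phi> where "\<Phi> s = cos \<theta> * ((C s)\<^sup>2 - (S s)\<^sup>2) - 2 * sin \<theta> * C s * S s - H s" for s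
  have pos: "1 + y\<^sup>2 \<noteq> 0" for y :: real
    by (metis add_cancel_left_left power2_eq_square sum_squares_eq_zero_iff zero_neq_one power_one)
  have derH: "(H has_real_derivative 2 * (cos (\<theta> + s\<^sup>2) * C s - sin (\<theta> + s\<^sup>2) * S s)) (at s within {0..t})"
    if s: "s \<in> {0..t}" for s
  proof -
    have "(H has_real_derivative integral (cbox 0 1) (\<lambda>y. 2 * s * cos (\<theta> + s\<^sup>2 * (1 + y\<^sup>2)))) (at s within {0..t})"
      unfolding H_def[abs_def]
    proof (rule leibniz_rule_field_derivative)
      show "((\<lambda>x. sin (\<theta> + x\<^sup>2 * (1 + y\<^sup>2)) / (1 + y\<^sup>2)) has_field_derivative
          2 * x * cos (\<theta> + x\<^sup>2 * (1 + y\<^sup>2))) (at x within {0..t})" for x y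
      proof -
        have "((\<lambda>x. sin (\<theta> + x\<^sup>2 * (1 + y\<^sup>2))) has_field_derivative
            2 * x * cos (\<theta> + x\<^sup>2 * (1 + y\<^sup>2)) * (1 + y\<^sup>2)) (at x within {0..t})"
          by (auto intro!: derivative_eq_intros)
        from DERIV_cdivide[OF this, of "1 + y\<^sup>2"] show ?thesis using pos[of y] by simp
      qed
      show "(\<lambda>y. sin (\<theta> + x\<^sup>2 * (1 + y\<^sup>2)) / (1 + y\<^sup>2)) integrable_on cbox 0 1" for x
        using pos by (intro integrable_continuous continuous_intros) auto
    qed (use s in \<open>auto intro!: continuous_intros simp: split_beta\<close>)
    moreover have "integral {0..1} (\<lambda>y. s * cos (\<theta> + s\<^sup>2 * (1 + y\<^sup>2))) = cos (\<theta> + s\<^sup>2) * C s - sin (\<theta> + s\<^sup>2) * S s"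
    proof -
      \<comment> \<open>\<open>v = s * y\<close> identifies the derivative of \<open>H\<close> with
        a Fresnel integral up to \<open>s\<close>; the shift by \<open>pi / 2\<close> turns the
        cosine into a sine.\<close>
      have "((\<lambda>y. s *\<^sub>R sin (pi / 2 + \<theta> + s\<^sup>2 + (s * y)\<^sup>2)) has_integral
          integral {s * 0..s * 1} (\<lambda>v. sin (pi / 2 + \<theta> + s\<^sup>2 + v\<^sup>2))) {0..1}"
        using s by (intro has_integral_substitution[where c = 0 and d = s])
          (auto intro!: derivative_eq_intros continuous_intros simp: mult_left_le)
      moreover have "sin (pi / 2 + \<theta> + s\<^sup>2 + (s * y)\<^sup>2) = cos (\<theta> + s\<^sup>2 * (1 + y\<^sup>2))" for y
      proof -
        have "pi / 2 + \<theta> + s\<^sup>2 + (s * y)\<^sup>2 = pi / 2 + (\<theta> + s\<^sup>2 * (1 + y\<^sup>2))"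
          by (simp add: algebra_simps)
        then show ?thesis by (simp only: sin_add) simp
      qed
      ultimately have "integral {0..1} (\<lambda>y. s * cos (\<theta> + s\<^sup>2 * (1 + y\<^sup>2))) = fresnel (pi / 2 + \<theta> + s\<^sup>2) s"
        by (simp add: fresnel_def has_integral_iff)
      also have "\<dots> = cos (\<theta> + s\<^sup>2) * C s - sin (\<theta> + s\<^sup>2) * S s"
        by (subst fresnel_sin_cos) (simp add: C_def S_def add.assoc sin_add[of "pi / 2"] cos_add[of "pi / 2"])
      finally show ?thesis .
    qed
    ultimately show ?thesis by (simp add: mult.assoc)
  qed
  have "(\<Phi> has_real_derivative 0) (at s within {0..t})" if s: "s \<in> {0..t}" for s
  proof -
    have C: "(C has_real_derivative cos (s\<^sup>2)) (at s within {0..t})"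
      and S: "(S has_real_derivative sin (s\<^sup>2)) (at s within {0..t})"
      using has_real_derivative_fresnel[OF s, of "pi / 2"] has_real_derivative_fresnel[OF s, of 0]
      by (simp_all add: C_def S_def sin_add)
    show ?thesis
      unfolding \<Phi>_def[abs_def]
      by (rule derivative_eq_intros refl C S derH[OF s])+ (simp add: sin_add cos_add algebra_simps)
  qed
  then obtain c where c: "\<And>s. s \<in> {0..t} \<Longrightarrow> \<Phi> s = c"
    using has_field_derivative_zero_constant[of "{0..t}" \<Phi>] by auto
  \<comment> \<open>The constant is read off at 0, where \<open>C\<close> and \<open>S\<close>
    vanish and \<open>H\<close> is \<open>sin \<theta>\<close> times this integral; this is the
    source of \<open>pi / 4\<close>.\<close>
  have "((\<lambda>y. 1 / (1 + y\<^sup>2)) has_integral arctan 1 - arctan 0) {0..1}"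
    by (rule fundamental_theorem_of_calculus)
      (auto simp flip: has_real_derivative_iff_has_vector_derivative
        intro!: derivative_eq_intros simp: field_simps)
  then have "H 0 = sin \<theta> * (pi / 4)"
    using integral_mult_right[of "{0..1}" "sin \<theta>" "\<lambda>y. 1 / (1 + y\<^sup>2)"]
    by (simp add: H_def arctan_one has_integral_iff)
  then have "\<Phi> 0 = - (sin \<theta> * (pi / 4))" by (simp add: \<Phi>_def C_def S_def)
  moreover have "\<Phi> t = \<Phi> 0" using c[of t] c[of 0] assms by simp
  ultimately show ?thesis
    unfolding \<Phi>_def H_def C_def S_def by (simp add: algebra_simps)
qed

text \<open>The phase is stationary at \<open>y = 0\<close>. On \<open>[0, 1/t]\<close> the trivial
  bound gives \<open>1 / t\<close>; beyond, the derivative of the phase is at least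
  \<open>2 * t\<close>, which gives \<open>4 / t\<close>.\<close>

lemma abs_fresnel_square_remainder_le:
  fixes \<theta> t :: real
  assumes t: "1 \<le> t"
  shows "\<bar>integral {0..1} (\<lambda>y. sin (\<theta> + t\<^sup>2 * (1 + y\<^sup>2)) / (1 + y\<^sup>2))\<bar> \<le> 5 / t"
proof -
  let ?f = "\<lambda>y. sin (\<theta> + t\<^sup>2 * (1 + y\<^sup>2)) / (1 + y\<^sup>2)"
  have pos: "0 < 1 + y\<^sup>2" for y :: real by (simp add: add_pos_nonneg)
  then have pos': "1 + y\<^sup>2 \<noteq> 0" for y :: real by (simp add: less_imp_neq[symmetric])
  have "integral {0..1 / t} ?f + integral {1 / t..1} ?f = integral {0..1} ?f"
  proof (rule Henstock_Kurzweil_Integration.integral_combine)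
    show "?f integrable_on {0..1}"
      using pos' by (intro integrable_continuous_real continuous_intros) auto
  qed (use t in auto)
  moreover have "norm (integral {0..1 / t} ?f) \<le> 1 * (1 / t - 0)"
  proof (rule integral_bound)
    show "norm (?f y) \<le> 1" for y
    proof -
      have "\<bar>sin (\<theta> + t\<^sup>2 * (1 + y\<^sup>2))\<bar> / (1 + y\<^sup>2) \<le> 1 / 1" by (rule frac_le) auto
      then show ?thesis using pos[of y] by simp
    qed
  qed (use t pos' in \<open>auto intro!: continuous_intros\<close>)
  moreover have "\<bar>integral {1 / t..1} (\<lambda>y. 1 / (1 + y\<^sup>2) * sin (\<theta> + t\<^sup>2 * (1 + y\<^sup>2)))\<bar>
      \<le> 8 * (1 / (1 + (1 / t)\<^sup>2)) / (2 * t)"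
  proof (rule van_der_corput_sin[where \<phi>' = "\<lambda>y. 2 * t\<^sup>2 * y"])
    show "antimono_on {1 / t..1} (\<lambda>y. 1 / (1 + y\<^sup>2))"
    proof (rule monotone_onI)
      fix y z :: real assume "y \<in> {1 / t..1}" "z \<in> {1 / t..1}" "y \<le> z"
      moreover have "0 \<le> 1 / t" using t by simp
      ultimately have "0 \<le> y" "y \<le> z" unfolding atLeastAtMost_iff by linarith+
      then have "y\<^sup>2 \<le> z\<^sup>2" by (intro power_mono)
      then show "1 / (1 + z\<^sup>2) \<le> 1 / (1 + y\<^sup>2)" using pos by (intro frac_le) auto
    qed
    show "2 * t \<le> 2 * t\<^sup>2 * y" if "y \<in> {1 / t..1}" for y
      using that t by (simp add: field_simps power2_eq_square)
    show "mono_on {1 / t..1} (\<lambda>y. 2 * t\<^sup>2 * y) \<or> antimono_on {1 / t..1} (\<lambda>y. 2 * t\<^sup>2 * y)"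
      by (intro disjI1 mono_onI mult_left_mono) auto
    show "0 < 2 * t" using t by simp
    show "1 / t \<le> 1" using t by simp
    show "0 \<le> 1 / (1 + y\<^sup>2)" for y :: real by simp
    show "continuous_on {1 / t..1} (\<lambda>y. 2 * t\<^sup>2 * y)" by (intro continuous_intros)
    show "((\<lambda>y. \<theta> + t\<^sup>2 * (1 + y\<^sup>2)) has_real_derivative 2 * t\<^sup>2 * y) (at y)" for y
      by (auto intro!: derivative_eq_intros)
  qed
  moreover have "8 * (1 / (1 + (1 / t)\<^sup>2)) / (2 * t) \<le> 8 * 1 / (2 * t)"
  proof (intro divide_right_mono mult_left_mono)
    have "1 / (1 + (1 / t)\<^sup>2) \<le> 1 / 1" by (intro frac_le) auto
    then show "1 / (1 + (1 / t)\<^sup>2) \<le> 1" by simp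
  qed (use t in auto)
  ultimately show ?thesis by simp
qed

lemma cos_ge_quadratic: "1 - y\<^sup>2 / 2 \<le> cos y" for y :: real
proof -
  have "cos y = 1 - 2 * (sin (y / 2))\<^sup>2" using cos_double_sin[of "y / 2"] by simp
  moreover have "(sin (y / 2))\<^sup>2 \<le> (y / 2)\<^sup>2"
    using abs_sin_x_le_abs_x[of "y / 2"] by (simp only: abs_le_square_iff)
  ultimately show ?thesis by (simp add: power_divide)
qed

text \<open>At \<open>a = sqrt (3/2)\<close> the contribution of the initial segment \<open>[0, a]\<close> already exceeds the bound
  \<open>1/a\<close> for the tail. This fixes the sign in \<open>(C + i S)\<^sup>2 = i \<pi>/4\<close>.\<close>

lemma fresnel_pi_half_ge:
  assumes b: "2 \<le> b"
  shows "- (1 / b) \<le> fresnel (pi / 2) b"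
proof -
  \<comment> \<open>What is needed is \<open>a\<^sup>2 - (a\<^sup>2) ^ 3 / 10 \<ge> 1\<close>;
    \<open>a\<^sup>2 = 3 / 2\<close> is a simple value that works.\<close>
  define a :: real where "a = sqrt (3 / 2)"
  have a: "a\<^sup>2 = 3 / 2" "a > 0" by (simp_all add: a_def)
  have "a \<le> 2" by (rule power2_le_imp_le) (use a in auto)
  then have ab: "a \<le> b" using b by simp
  have "((\<lambda>v. 1 - v ^ 4 / 2) has_integral (a - a ^ 5 / 10) - (0 - 0 ^ 5 / 10)) {0..a}"
  proof (rule fundamental_theorem_of_calculus)
    show "((\<lambda>v. v - v ^ 5 / 10) has_vector_derivative 1 - v ^ 4 / 2) (at v within {0..a})" for v
      unfolding has_real_derivative_iff_has_vector_derivative[symmetric]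
      by (auto intro!: derivative_eq_intros)
  qed (use a in simp)
  then have "a - a ^ 5 / 10 = integral {0..a} (\<lambda>v. 1 - v ^ 4 / 2)"
    by (simp add: has_integral_iff)
  also have "\<dots> \<le> fresnel (pi / 2) a"
    unfolding fresnel_def
  proof (intro integral_le integrable_continuous_real continuous_intros)
    show "1 - v ^ 4 / 2 \<le> sin (pi / 2 + v\<^sup>2)" for v :: real
      using cos_ge_quadratic[of "v\<^sup>2"] by (simp add: sin_add)
  qed auto
  finally have 1: "a - a ^ 5 / 10 \<le> fresnel (pi / 2) a" .
  let ?f = "\<lambda>v::real. 2 * v * cos (v\<^sup>2)"
  have F: "integral {p..q} ?f = sin (q\<^sup>2) - sin (p\<^sup>2)" if "p \<le> q" for p q
  proof -
    have "(?f has_integral sin (q\<^sup>2) - sin (p\<^sup>2)) {p..q}"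
      using that by (intro fundamental_theorem_of_calculus)
        (auto simp flip: has_real_derivative_iff_has_vector_derivative intro!: derivative_eq_intros)
    then show ?thesis by (simp add: has_integral_iff)
  qed
  have int: "?f integrable_on {a..b}" by (intro integrable_continuous_real continuous_intros)
  have mono: "- (1 / (2 * x)) \<le> - (1 / (2 * y))" if "a \<le> x" "x \<le> y" for x y
    using that a(2) by (simp add: frac_le)
  \<comment> \<open>The amplitude lemma would give \<open>2 / a\<close>, more than the bound for the
    initial segment provides. Keeping the end points apart leaves \<open>1 / a\<close> at
    \<open>a\<close> and a vanishing \<open>1 / b\<close>. The amplitude is negated to make it
    increasing.\<close>
  obtain c where c: "c \<in> {a..b}" and "integral {a..b} (\<lambda>v. - (1 / (2 * v)) * ?f v)
      = - (1 / (2 * a)) * integral {a..c} ?f + - (1 / (2 * b)) * integral {c..b} ?f"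
    by (rule second_mean_value_theorem[OF int ab, of "\<lambda>v. - (1 / (2 * v))"]) (use mono in auto)
  moreover have "integral {a..b} (\<lambda>v. - (1 / (2 * v)) * ?f v) = integral {a..b} (\<lambda>v. - cos (v\<^sup>2))"
    using a by (intro integral_cong) auto
  ultimately have "integral {a..b} (\<lambda>v. cos (v\<^sup>2)) = (1 / (2 * a)) * (sin (c\<^sup>2) - sin (a\<^sup>2)) + (1 / (2 * b)) * (sin (b\<^sup>2) - sin (c\<^sup>2))"
    using F[of a c] F[of c b] by simp
  moreover have "(1 / (2 * a)) * (- 2) \<le> (1 / (2 * a)) * (sin (c\<^sup>2) - sin (a\<^sup>2))"
  proof (rule mult_left_mono)
    show "- 2 \<le> sin (c\<^sup>2) - sin (a\<^sup>2)"
      using sin_ge_minus_one[of "c\<^sup>2"] sin_le_one[of "a\<^sup>2"] by linarith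
  qed (use a in simp)
  moreover have "(1 / (2 * b)) * (- 2) \<le> (1 / (2 * b)) * (sin (b\<^sup>2) - sin (c\<^sup>2))"
  proof (rule mult_left_mono)
    show "- 2 \<le> sin (b\<^sup>2) - sin (c\<^sup>2)"
      using sin_ge_minus_one[of "b\<^sup>2"] sin_le_one[of "c\<^sup>2"] by linarith
  qed (use b in simp)
  ultimately have 2: "- (1 / a) - 1 / b \<le> fresnel (pi / 2) b - fresnel (pi / 2) a"
    using a ab by (simp add: fresnel_diff sin_add)
  have "a * (a - a ^ 5 / 10 - 1 / a) = a\<^sup>2 - (a\<^sup>2) ^ 3 / 10 - 1"
  proof -
    have "a * (a - a ^ 5 / 10 - 1 / a) = a * a - a * a ^ 5 / 10 - a * (1 / a)"
      by (simp add: right_diff_distrib)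
    moreover have "a * (1 / a) = 1" using a(2) by simp
    moreover have "a * a ^ 5 = (a\<^sup>2) ^ 3" by (simp flip: power_mult power_Suc)
    ultimately show ?thesis by (simp only: power2_eq_square)
  qed
  also have "\<dots> \<ge> 0" unfolding a by (simp add: power3_eq_cube)
  finally have "0 \<le> a - a ^ 5 / 10 - 1 / a"
    using a(2) by (simp add: zero_le_mult_iff)
  with 1 2 show ?thesis by linarith
qed

text \<open>The Cauchy criterion gives limits \<open>c\<close> and \<open>s\<close> of the two basic
  integrals, and the square identity passes to the limit: phase 0 yields
  \<open>s\<^sup>2 = c\<^sup>2\<close>, phase \<open>pi / 2\<close> yields
  \<open>c * s = pi / 8\<close>. With \<open>0 \<le> c\<close> only
  \<open>c = s = sqrt (pi / 8)\<close> is left.\<close>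

lemma fresnel_tendsto:
  "(\<lambda>n. fresnel \<theta> (real n)) \<longlonglongrightarrow> sqrt pi / 2 * sin (\<theta> + pi / 4)"
proof -
  have conv: "convergent (\<lambda>n. fresnel \<eta> (real n))" for \<eta>
  proof (rule Cauchy_convergent, rule CauchyI')
    fix e :: real assume e: "e > 0"
    obtain M where M: "real M > 4 / e" using reals_Archimedean2 by blast
    have "0 < 4 / e" using e by simp
    then have M0: "0 < real M" using M by linarith
    have "dist (fresnel \<eta> (real m)) (fresnel \<eta> (real n)) < e" if "m \<ge> M" "n > m" for m n
    proof -
      have "\<bar>fresnel \<eta> (real n) - fresnel \<eta> (real m)\<bar> \<le> 4 / real m"
        using that M0 by (intro abs_fresnel_diff_le) auto
      also have "\<dots> \<le> 4 / real M" using that M0 by (intro divide_left_mono) auto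
      also have "\<dots> < e" using M M0 e by (simp add: field_simps)
      finally show ?thesis by (simp add: dist_real_def abs_minus_commute)
    qed
    then show "\<exists>M. \<forall>m\<ge>M. \<forall>n>m. dist (fresnel \<eta> (real m)) (fresnel \<eta> (real n)) < e" by blast
  qed
  then obtain c s where c: "(\<lambda>n. fresnel (pi / 2) (real n)) \<longlonglongrightarrow> c" and s: "(\<lambda>n. fresnel 0 (real n)) \<longlonglongrightarrow> s"
    unfolding convergent_def by blast
  have eq: "cos \<eta> * (c\<^sup>2 - s\<^sup>2) - 2 * sin \<eta> * c * s + pi / 4 * sin \<eta> = 0" for \<eta>
  proof (rule LIMSEQ_unique)
    let ?X = "\<lambda>n. cos \<eta> * ((fresnel (pi / 2) (real n))\<^sup>2 - (fresnel 0 (real n))\<^sup>2)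
        - 2 * sin \<eta> * fresnel (pi / 2) (real n) * fresnel 0 (real n) + pi / 4 * sin \<eta>"
    show "?X \<longlonglongrightarrow> cos \<eta> * (c\<^sup>2 - s\<^sup>2) - 2 * sin \<eta> * c * s + pi / 4 * sin \<eta>"
      by (intro tendsto_intros c s)
    have "(\<lambda>n. 5 / real n) \<longlonglongrightarrow> 0"
      by (rule tendsto_divide_0[OF tendsto_const filterlim_at_top_imp_at_infinity[OF filterlim_real_sequentially]])
    then show "?X \<longlonglongrightarrow> 0"
    proof (rule Lim_null_comparison[rotated])
      show "\<forall>\<^sub>F n in sequentially. norm (?X n) \<le> 5 / real n"
        using eventually_ge_at_top[of 1]
      proof eventually_elim
        case (elim n)
        have "norm (?X n) = \<bar>integral {0..1} (\<lambda>y. sin (\<eta> + (real n)\<^sup>2 * (1 + y\<^sup>2)) / (1 + y\<^sup>2))\<bar>"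
          unfolding real_norm_def by (subst fresnel_square_eq) simp_all
        also have "\<dots> \<le> 5 / real n" using elim by (intro abs_fresnel_square_remainder_le) simp
        finally show ?case .
      qed
    qed
  qed
  have "s\<^sup>2 = c\<^sup>2" using eq[of 0] by simp
  then have "s = c \<or> s = - c" by (simp only: power2_eq_iff)
  moreover have cs: "c * s = pi / 8" using eq[of "pi / 2"] by simp
  moreover have "0 \<le> c"
  proof (rule LIMSEQ_le)
    show "(\<lambda>n. - (1 / real n)) \<longlonglongrightarrow> 0"
      using tendsto_minus[OF lim_1_over_n] by simp
    show "\<exists>M. \<forall>n\<ge>M. - (1 / real n) \<le> fresnel (pi / 2) (real n)"
      by (rule exI[of _ 2]) (use fresnel_pi_half_ge in force)
  qed (rule c)
  moreover have "s \<noteq> - c"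
  proof
    assume "s = - c"
    then have "c * s \<le> 0" by simp
    then show False using cs pi_gt_zero by linarith
  qed
  ultimately have "s = c" by blast
  with cs have "c\<^sup>2 = pi / 8" by (simp add: power2_eq_square)
  then have "c = sqrt (pi / 8)" using \<open>0 \<le> c\<close> by (simp add: real_sqrt_unique)
  also have "\<dots> = sqrt pi / 2 * (sqrt 2 / 2)"
  proof -
    have "sqrt 8 = 2 * sqrt 2" using real_sqrt_mult[of 4 2] by simp
    then show ?thesis by (simp add: real_sqrt_divide field_simps)
  qed
  finally have c_eq: "c = sqrt pi / 2 * (sqrt 2 / 2)" .
  have "(\<lambda>n. fresnel \<theta> (real n)) \<longlonglongrightarrow> sin \<theta> * c + cos \<theta> * s"
    unfolding fresnel_sin_cos[of \<theta>] by (intro tendsto_intros c s)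
  moreover have "sin \<theta> * c + cos \<theta> * s = sqrt pi / 2 * sin (\<theta> + pi / 4)"
    unfolding \<open>s = c\<close> c_eq by (simp add: sin_add sin_45 cos_45 algebra_simps)
  ultimately show ?thesis by simp
qed

text \<open>The bound for a difference does not depend on the upper point, so it suffices to let
  that point run through the integers.\<close>

lemma fresnel_asymptotics:
  assumes "0 < t"
  shows "\<bar>fresnel \<theta> t - sqrt pi / 2 * sin (\<theta> + pi / 4)\<bar> \<le> 4 / t"
proof (rule LIMSEQ_le_const2)
  show "(\<lambda>n. \<bar>fresnel \<theta> t - fresnel \<theta> (real n)\<bar>) \<longlonglongrightarrow> \<bar>fresnel \<theta> t - sqrt pi / 2 * sin (\<theta> + pi / 4)\<bar>"
    by (intro tendsto_intros fresnel_tendsto)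
  show "\<exists>M. \<forall>n\<ge>M. \<bar>fresnel \<theta> t - fresnel \<theta> (real n)\<bar> \<le> 4 / t"
  proof (intro exI allI impI)
    fix n assume "nat \<lceil>t\<rceil> \<le> n"
    then have "t \<le> real n" by linarith
    then show "\<bar>fresnel \<theta> t - fresnel \<theta> (real n)\<bar> \<le> 4 / t"
      using abs_fresnel_diff_le[OF assms, of "real n" \<theta>] by (simp add: abs_minus_commute)
  qed
qed

text \<open>For an end point close to the stationary point, where \<open>4 / t\<close> is
  useless.\<close>

lemma fresnel_minus_limit_le_5:
  assumes "0 \<le> t"
  shows "\<bar>fresnel \<theta> t - sqrt pi / 2 * sin (\<theta> + pi / 4)\<bar> \<le> 5"
proof (cases "t \<le> 1")
  case True
  then show ?thesis
    using abs_fresnel_diff_le_length[OF assms True, of \<theta>] fresnel_asymptotics[of 1 \<theta>] assms by linarith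
next
  case False
  then have "4 / t \<le> 4" by (simp add: field_simps)
  then show ?thesis using fresnel_asymptotics[of t \<theta>] False by linarith
qed

section \<open>Stationary phase\<close>

text \<open>The amplitude is replaced by its value \<open>1 / sqrt l\<close> at
  \<open>w = 0\<close>, which leaves a Fresnel integral. The difference of the amplitudes carries a
  factor \<open>w\<^sup>2\<close>: one \<open>w\<close> joins the sine to form the exactly
  integrable \<open>2 * w * sin (2 * l + w\<^sup>2)\<close>, the other one goes into the increasing
  bounded factor \<open>w / r w\<close>. Two uses of the amplitude lemma then bound the rest by
  \<open>1 / l\<close>, uniformly in \<open>W\<close>.\<close>

lemma integral_stationary_half:
  assumes l: "0 < l" and W: "0 \<le> W"
  shows "\<bar>integral {0..W} (\<lambda>w. sin (2 * l + w\<^sup>2) * (2 / sqrt (w\<^sup>2 + 4 * l))) - sqrt (pi / l) / 2 * sin (2 * l + pi / 4)\<bar>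
      \<le> 1 / l + \<bar>fresnel (2 * l) W - sqrt pi / 2 * sin (2 * l + pi / 4)\<bar> / sqrt l"
proof -
  define r where "r w = sqrt (w\<^sup>2 + 4 * l)" for w
  define r0 where "r0 = 2 * sqrt l"
  have r0: "0 < r0" "r0\<^sup>2 = 4 * l" using l by (simp_all add: r0_def power_mult_distrib)
  have r: "r0 \<le> r w" "(r w)\<^sup>2 = w\<^sup>2 + 4 * l" "0 < r w" "\<bar>w\<bar> \<le> r w" for w
  proof -
    show "(r w)\<^sup>2 = w\<^sup>2 + 4 * l" using l by (simp add: r_def)
    have "r0 = sqrt (4 * l)" by (simp add: r0_def real_sqrt_mult)
    then show "r0 \<le> r w" by (simp add: r_def)
    then show "0 < r w" using r0 by linarith
    have "\<bar>w\<bar> = sqrt (w\<^sup>2)" by simp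
    then show "\<bar>w\<bar> \<le> r w" using l by (simp only: r_def real_sqrt_le_iff)
  qed
  have rne: "r w \<noteq> 0" "r w + r0 \<noteq> 0" for w using r(3)[of w] r0 by linarith+
  have contr: "continuous_on S r" for S unfolding r_def by (intro continuous_intros)
  let ?g = "\<lambda>w. 2 * w * sin (2 * l + w\<^sup>2)"
  have FTC: "integral {c..d} ?g = cos (2 * l + c\<^sup>2) - cos (2 * l + d\<^sup>2)" if "c \<le> d" for c d
  proof -
    have "(?g has_integral (- cos (2 * l + d\<^sup>2)) - (- cos (2 * l + c\<^sup>2))) {c..d}"
      using that by (intro fundamental_theorem_of_calculus)
        (auto simp flip: has_real_derivative_iff_has_vector_derivative intro!: derivative_eq_intros)
    then show ?thesis by (simp add: has_integral_iff)
  qed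
  have mono: "r v \<le> r w" if "0 \<le> v" "v \<le> w" for v w
    using that l by (simp add: r_def power_mono)
  have inner: "\<bar>integral {c..d} (\<lambda>w. 1 / (r w + r0) * ?g w)\<bar> \<le> 2 / r0" if cd: "0 \<le> c" "c \<le> d" for c d
  proof -
    have "\<bar>integral {c..d} (\<lambda>w. 1 / (r w + r0) * ?g w)\<bar> \<le> 2 * (1 / (2 * r0)) * 2"
    proof (rule abs_integral_monotone_amplitude_le)
      have "antimono_on {c..d} (\<lambda>w. 1 / (r w + r0))"
      proof (rule monotone_onI)
        fix v w assume "v \<in> {c..d}" "w \<in> {c..d}" "v \<le> w"
        then have "r v \<le> r w" using cd by (intro mono) auto
        then show "1 / (r w + r0) \<le> 1 / (r v + r0)"
          using r(3)[of v] r0 by (intro frac_le) auto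
      qed
      then show "mono_on {c..d} (\<lambda>w. 1 / (r w + r0)) \<or> antimono_on {c..d} (\<lambda>w. 1 / (r w + r0))" ..
      show "\<bar>1 / (r w + r0)\<bar> \<le> 1 / (2 * r0)" for w
        using r(1)[of w] r(3)[of w] r0 by (simp add: frac_le)
      show "\<bar>integral {p..q} ?g\<bar> \<le> 2" if "p \<le> q" for p q
        unfolding FTC[OF that] using abs_cos_le_one[of "2 * l + p\<^sup>2"] abs_cos_le_one[of "2 * l + q\<^sup>2"] by linarith
    qed (use cd in \<open>auto intro!: continuous_intros\<close>)
    then show ?thesis by simp
  qed
  have "\<bar>integral {0..W} (\<lambda>w. w / r w * (1 / (r w + r0) * ?g w))\<bar> \<le> 2 * 1 * (2 / r0)"
  proof (rule abs_integral_monotone_amplitude_le)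
    have "mono_on {0..W} (\<lambda>w. w / r w)"
    proof (rule monotone_onI)
      fix v w assume vw: "v \<in> {0..W}" "w \<in> {0..W}" "v \<le> w"
      have "(v * r w)\<^sup>2 \<le> (w * r v)\<^sup>2"
        using vw l by (simp add: power_mult_distrib r(2) distrib_left power_mono mult.commute)
      then have "v * r w \<le> w * r v"
        by (rule power2_le_imp_le) (use vw r(3)[of v] in auto)
      then show "v / r v \<le> w / r w" using r(3)[of v] r(3)[of w] by (simp add: divide_simps)
    qed
    then show "mono_on {0..W} (\<lambda>w. w / r w) \<or> antimono_on {0..W} (\<lambda>w. w / r w)" ..
    show "\<bar>w / r w\<bar> \<le> 1" for w using r(3)[of w] r(4)[of w] by simp
    show "continuous_on {0..W} (\<lambda>w. 1 / (r w + r0) * ?g w)"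
      using rne by (intro continuous_intros contr) auto
  qed (use W inner in auto)
  then have rest: "\<bar>integral {0..W} (\<lambda>w. w / r w * (1 / (r w + r0) * ?g w)) / r0\<bar> \<le> 1 / l"
  proof -
    assume "\<bar>integral {0..W} (\<lambda>w. w / r w * (1 / (r w + r0) * ?g w))\<bar> \<le> 2 * 1 * (2 / r0)"
    then have "\<bar>integral {0..W} (\<lambda>w. w / r w * (1 / (r w + r0) * ?g w))\<bar> / r0 \<le> (4 / r0) / r0"
      using r0(1) by (intro divide_right_mono) auto
    also have "(4 / r0) / r0 = 4 / r0\<^sup>2" by (simp add: power2_eq_square)
    also have "\<dots> = 1 / l" unfolding r0(2) by simp
    finally show ?thesis using r0(1) by (simp only: abs_divide abs_of_pos)
  qed
  have "integral {0..W} (\<lambda>w. sin (2 * l + w\<^sup>2) * (2 / r w))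
      = integral {0..W} (\<lambda>w. sin (2 * l + w\<^sup>2) / sqrt l - w / r w * (1 / (r w + r0) * ?g w) / r0)"
  proof (rule integral_cong)
    fix w
    have "2 / r0 - 2 / r w = 2 * w\<^sup>2 / (r w * (r w + r0) * r0)"
    proof -
      have "(r w - r0) * (r w + r0) = w\<^sup>2" using r(2)[of w] r0(2) by (simp add: algebra_simps power2_eq_square)
      then have "2 * w\<^sup>2 / (r w * (r w + r0) * r0) = 2 * (r w - r0) / (r w * r0)"
        using rne[of w] r0 by (simp add: divide_simps) (simp add: algebra_simps)
      then show ?thesis using rne[of w] r0 by (simp add: divide_simps)
    qed
    moreover have "2 / r0 = 1 / sqrt l" using l by (simp add: r0_def)
    ultimately have *: "2 / r w = 1 / sqrt l - 2 * w\<^sup>2 / (r w * (r w + r0) * r0)" by simp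
    show "sin (2 * l + w\<^sup>2) * (2 / r w) = sin (2 * l + w\<^sup>2) / sqrt l - w / r w * (1 / (r w + r0) * ?g w) / r0"
      unfolding * by (simp add: right_diff_distrib power2_eq_square mult_ac)
  qed
  also have "\<dots> = fresnel (2 * l) W / sqrt l - integral {0..W} (\<lambda>w. w / r w * (1 / (r w + r0) * ?g w)) / r0"
    unfolding fresnel_def integral_divide[symmetric] using l rne r0
    by (intro integral_diff integrable_continuous_real continuous_intros contr) auto
  finally have eq: "integral {0..W} (\<lambda>w. sin (2 * l + w\<^sup>2) * (2 / r w))
      = fresnel (2 * l) W / sqrt l - integral {0..W} (\<lambda>w. w / r w * (1 / (r w + r0) * ?g w)) / r0" .
  have main: "sqrt (pi / l) / 2 * sin (2 * l + pi / 4) = (sqrt pi / 2 * sin (2 * l + pi / 4)) / sqrt l"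
    by (simp add: real_sqrt_divide)
  have "\<bar>fresnel (2 * l) W / sqrt l - (sqrt pi / 2 * sin (2 * l + pi / 4)) / sqrt l\<bar>
      = \<bar>fresnel (2 * l) W - sqrt pi / 2 * sin (2 * l + pi / 4)\<bar> / sqrt l"
    using l by (simp only: diff_divide_distrib[symmetric] abs_divide abs_of_pos real_sqrt_gt_zero)
  then show ?thesis
    unfolding r_def[symmetric] eq main using rest by linarith
qed

text \<open>The substitution \<open>w = sqrt (a t) - sqrt (x / t)\<close> turns the phase \<open>x / t + a t\<close> into \<open>2 l + w\<^sup>2\<close>
  with \<open>l = sqrt (a x)\<close>.\<close>

lemma integral_stationary_phase:
  fixes a x N B :: real
  assumes a: "0 < a" and x: "0 < x" and N: "0 < N" "N \<le> B"
  defines "l \<equiv> sqrt (a * x)"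
  defines "V \<equiv> sqrt (x / N) - sqrt (a * N)" and "W \<equiv> sqrt (a * B) - sqrt (x / B)"
  assumes V: "0 \<le> V" and W: "0 \<le> W"
  shows "\<bar>integral {N..B} (\<lambda>t. 1 / t * sin (x / t + a * t)) - sqrt (pi / l) * sin (2 * l + pi / 4)\<bar>
      \<le> 2 / l + (\<bar>fresnel (2 * l) V - sqrt pi / 2 * sin (2 * l + pi / 4)\<bar>
          + \<bar>fresnel (2 * l) W - sqrt pi / 2 * sin (2 * l + pi / 4)\<bar>) / sqrt l"
proof -
  have l: "0 < l" using a x by (simp add: l_def)
  define F where "F w = sin (2 * l + w\<^sup>2) * (2 / sqrt (w\<^sup>2 + 4 * l))" for w
  define g where "g t = sqrt (a * t) - sqrt (x / t)" for t
  define g' where "g' t = (sqrt (a * t) + sqrt (x / t)) / (2 * t)" for t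
  have Fpos: "w\<^sup>2 + 4 * l > 0" for w using l by (intro add_nonneg_pos) auto
  have contF: "continuous_on S F" for S
    unfolding F_def using Fpos by (intro continuous_intros) (auto simp: less_imp_neq[symmetric])
  have gN: "g N = - V" and gB: "g B = W" by (simp_all add: g_def V_def W_def)
  have gmono: "g s \<le> g t" if "0 < s" "s \<le> t" for s t
    unfolding g_def using that a x
    by (intro diff_mono real_sqrt_le_mono mult_left_mono divide_left_mono) auto
  have "((\<lambda>t. g' t *\<^sub>R F (g t)) has_integral integral {g N..g B} F) {N..B}"
  proof (rule has_integral_substitution[where c = "g N" and d = "g B"])
    show "g N \<le> g B" using N by (intro gmono) auto
    show "g ` {N..B} \<subseteq> {g N..g B}" using N by (auto intro!: gmono)
    show "(g has_real_derivative g' t) (at t within {N..B})" if "t \<in> {N..B}" for t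
    proof -
      have t: "t > 0" using that N by auto
      have "((\<lambda>t. sqrt (a * t)) has_real_derivative sqrt (a * t) / (2 * t)) (at t)"
      proof -
        have "((\<lambda>t. sqrt (a * t)) has_real_derivative a * (inverse (sqrt (a * t)) / 2)) (at t)"
          using mult_pos_pos[OF a t] by (auto intro!: derivative_eq_intros)
        moreover have "a * (inverse (sqrt (a * t)) / 2) = sqrt (a * t) / (2 * t)"
        proof -
          define q where "q = sqrt (a * t)"
          have "0 < a * t" using t a by simp
          then have "q > 0" "q * q = a * t" by (simp_all add: q_def)
          then show ?thesis unfolding q_def[symmetric] using t by (simp add: field_simps)
        qed
        ultimately show ?thesis by (simp only:)
      qed
      moreover have "((\<lambda>t. sqrt (x / t)) has_real_derivative - (sqrt (x / t) / (2 * t))) (at t)"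
      proof -
        have "((\<lambda>t. x / t) has_real_derivative - x / t\<^sup>2) (at t)"
          using t by (auto intro!: derivative_eq_intros simp: power2_eq_square)
        then have "((\<lambda>t. sqrt (x / t)) has_real_derivative (inverse (sqrt (x / t)) / 2) * (- x / t\<^sup>2)) (at t)"
          using DERIV_real_sqrt[OF divide_pos_pos[OF x t]] by (rule DERIV_chain2[rotated])
        moreover have "(inverse (sqrt (x / t)) / 2) * (- x / t\<^sup>2) = - (sqrt (x / t) / (2 * t))"
        proof -
          define q where "q = sqrt (x / t)"
          have q: "q > 0" "x = q * q * t" using t x by (simp_all add: q_def)
          show ?thesis unfolding q_def[symmetric] q(2) using t q(1) by (simp add: field_simps power2_eq_square)
        qed
        ultimately show ?thesis by (simp only:)
      qed
      ultimately have "(g has_real_derivative sqrt (a * t) / (2 * t) - - (sqrt (x / t) / (2 * t))) (at t)"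
        unfolding g_def[abs_def] by (rule DERIV_diff)
      then show ?thesis
        by (rule has_field_derivative_at_within[OF DERIV_cong]) (simp add: g'_def add_divide_distrib)
    qed
  qed (use N contF in auto)
  then have sub: "integral {N..B} (\<lambda>t. g' t *\<^sub>R F (g t)) = integral {- V..W} F"
    unfolding gN gB by (rule integral_unique)
  have "g' t *\<^sub>R F (g t) = 1 / t * sin (x / t + a * t)" if "t \<in> {N..B}" for t
  proof -
    have t: "t > 0" using that N by auto
    define p where "p = sqrt (a * t)"
    define q where "q = sqrt (x / t)"
    have pq: "p > 0" "q > 0" "p * q = l" "p\<^sup>2 = a * t" "q\<^sup>2 = x / t"
      using t a x by (simp_all add: p_def q_def l_def flip: real_sqrt_mult)
    have gt: "g t = p - q" "g' t = (p + q) / (2 * t)" by (simp_all add: g_def g'_def p_def q_def)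
    \<comment> \<open>By this identity the factor \<open>(p + q) / (2 * t)\<close> from
      \<open>g'\<close> cancels against the amplitude \<open>2 / (p + q)\<close> of
      \<open>F\<close>, and exactly \<open>1 / t\<close> is left.\<close>
    have "(p - q)\<^sup>2 + 4 * l = (p + q)\<^sup>2" using pq(3) by (simp add: power2_eq_square algebra_simps)
    then have "sqrt ((g t)\<^sup>2 + 4 * l) = p + q" using pq by (simp add: gt)
    moreover have "2 * l + (g t)\<^sup>2 = x / t + a * t"
      using pq by (simp add: gt power2_diff)
    ultimately have "g' t *\<^sub>R F (g t) = (p + q) / (2 * t) * (sin (x / t + a * t) * (2 / (p + q)))"
      by (simp only: F_def gt(2) real_scaleR_def)
    then show ?thesis using t pq(1,2) by (simp add: add_pos_pos less_imp_neq[symmetric])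
  qed
  then have "integral {N..B} (\<lambda>t. g' t *\<^sub>R F (g t)) = integral {N..B} (\<lambda>t. 1 / t * sin (x / t + a * t))"
    by (rule integral_cong)
  with sub have eq: "integral {N..B} (\<lambda>t. 1 / t * sin (x / t + a * t)) = integral {- V..W} F"
    by (simp only:)
  have "integral {- V..0} F + integral {0..W} F = integral {- V..W} F"
    using V W by (intro Henstock_Kurzweil_Integration.integral_combine integrable_continuous_real contF) auto
  \<comment> \<open>\<open>F\<close> is even, so either side of the stationary point contributes
    half of the main term.\<close>
  moreover have "integral {- V..0} F = integral {0..V} F"
  proof -
    have "F (- w) = F w" for w by (simp add: F_def)
    then show ?thesis
      using Henstock_Kurzweil_Integration.integral_reflect_real[of V 0 F] by simp
  qed
  moreover have "\<bar>integral {0..u} F - sqrt (pi / l) / 2 * sin (2 * l + pi / 4)\<bar>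
      \<le> 1 / l + \<bar>fresnel (2 * l) u - sqrt pi / 2 * sin (2 * l + pi / 4)\<bar> / sqrt l" if "0 \<le> u" for u
    unfolding F_def using integral_stationary_half[OF l that] .
  from this[OF V] this[OF W] calculation show ?thesis
    unfolding eq add_divide_distrib by simp
qed

section \<open>The phases of a single frequency\<close>

lemma antimono_on_inverse_pos:
  fixes N B :: real
  assumes "0 < N"
  shows "antimono_on {N..B} (\<lambda>t. 1 / t)"
  using assms by (intro monotone_onI frac_le) auto

lemma divide_square_antimono:
  fixes x s t :: real
  assumes "0 \<le> x" "0 < s" "s \<le> t"
  shows "x / t\<^sup>2 \<le> x / s\<^sup>2"
  using assms by (intro divide_left_mono power_mono) auto

text \<open>After a change of sign the phase has derivative \<open>a + x / t\<^sup>2\<close>, which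
  is at least \<open>a\<close>.\<close>

lemma abs_integral_minus_phase_le:
  fixes a x N B :: real
  assumes a: "0 < a" and x: "0 \<le> x" and N: "0 < N" "N \<le> B"
  shows "\<bar>integral {N..B} (\<lambda>t. 1 / t * sin (x / t - a * t))\<bar> \<le> 8 / (N * a)"
proof -
  have "\<bar>integral {N..B} (\<lambda>t. 1 / t * sin (a * t - x / t))\<bar> \<le> 8 * (1 / N) / a"
  proof (rule van_der_corput_sin[where \<phi>' = "\<lambda>t. a + x / t\<^sup>2"])
    show "((\<lambda>t. a * t - x / t) has_real_derivative a + x / t\<^sup>2) (at t)" if "t \<in> {N..B}" for t
      using that N by (auto intro!: derivative_eq_intros simp: power2_eq_square)
    show "continuous_on {N..B} (\<lambda>t. a + x / t\<^sup>2)"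
      using N by (intro continuous_intros) auto
    have "antimono_on {N..B} (\<lambda>t. a + x / t\<^sup>2)"
      using N x by (intro monotone_onI add_left_mono divide_square_antimono) auto
    then show "mono_on {N..B} (\<lambda>t. a + x / t\<^sup>2) \<or> antimono_on {N..B} (\<lambda>t. a + x / t\<^sup>2)" ..
    show "antimono_on {N..B} (\<lambda>t. 1 / t)" using N by (intro antimono_on_inverse_pos)
  qed (use a x N in auto)
  moreover have "1 / t * sin (x / t - a * t) = - (1 / t * sin (a * t - x / t))" for t
    using sin_minus[of "a * t - x / t"] by simp
  ultimately show ?thesis by simp
qed

text \<open>The derivative \<open>a - x / t\<^sup>2\<close> increases, so it is smallest at
  \<open>N\<close>. For \<open>a = 2 * pi * m\<close> and \<open>x = 2 * pi * M * N\<^sup>2\<close>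
  this minimum is \<open>2 * pi * (m - M)\<close>.\<close>

lemma abs_integral_plus_phase_le:
  fixes a x N B :: real
  assumes a: "x / N\<^sup>2 < a" and x: "0 \<le> x" and N: "0 < N" "N \<le> B"
  shows "\<bar>integral {N..B} (\<lambda>t. 1 / t * sin (x / t + a * t))\<bar> \<le> 8 / (N * (a - x / N\<^sup>2))"
proof -
  have "\<bar>integral {N..B} (\<lambda>t. 1 / t * sin (x / t + a * t))\<bar> \<le> 8 * (1 / N) / (a - x / N\<^sup>2)"
  proof (rule van_der_corput_sin[where \<phi>' = "\<lambda>t. a - x / t\<^sup>2"])
    show "((\<lambda>t. x / t + a * t) has_real_derivative a - x / t\<^sup>2) (at t)" if "t \<in> {N..B}" for t
      using that N by (auto intro!: derivative_eq_intros simp: power2_eq_square)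
    show "continuous_on {N..B} (\<lambda>t. a - x / t\<^sup>2)"
      using N by (intro continuous_intros) auto
    have "mono_on {N..B} (\<lambda>t. a - x / t\<^sup>2)"
      using N x by (intro monotone_onI diff_left_mono divide_square_antimono) auto
    then show "mono_on {N..B} (\<lambda>t. a - x / t\<^sup>2) \<or> antimono_on {N..B} (\<lambda>t. a - x / t\<^sup>2)" ..
    show "a - x / N\<^sup>2 \<le> a - x / t\<^sup>2" if "t \<in> {N..B}" for t
      using that N x by (intro diff_left_mono divide_square_antimono) auto
    show "antimono_on {N..B} (\<lambda>t. 1 / t)" using N by (intro antimono_on_inverse_pos)
  qed (use a x N in auto)
  then show ?thesis by simp
qed

text \<open>Near the end point \<open>N\<close> the phase is almost stationary; the piece of length \<open>sqrt (N / M)\<close> is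
  estimated trivially and the rest by the derivative of the phase.\<close>

lemma abs_integral_plus_phase_transitional_le:
  fixes m M N B :: real
  assumes M: "1 \<le> M" and N: "1 \<le> N" and mM: "M \<le> m" and B: "2 * N \<le> B"
  shows "\<bar>integral {N..B} (\<lambda>t. 1 / t * sin ((2 * pi * M * N\<^sup>2) / t + 2 * pi * m * t))\<bar> \<le> 4 / sqrt (M * N)"
proof -
  define x where "x = 2 * pi * M * N\<^sup>2"
  define a where "a = 2 * pi * m"
  \<comment> \<open>This length balances the trivial bound \<open>d / N\<close> against the
    derivative bound of order \<open>1 / (M * d)\<close>: both become
    \<open>1 / sqrt (M * N)\<close>.\<close>
  define d where "d = sqrt (N / M)"
  let ?f = "\<lambda>t. 1 / t * sin (x / t + a * t)"
  have x: "0 < x" using M N by (simp add: x_def)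
  have d: "0 < d" "d * d = N / M" using M N by (simp_all add: d_def)
  have "d \<le> N"
  proof (rule power2_le_imp_le)
    have "N * 1 \<le> N * (N * M)" using M N mult_mono[of 1 N 1 M] by (intro mult_left_mono) auto
    then have "N / M \<le> N * N" using M by (simp add: divide_le_eq mult.assoc)
    then show "d\<^sup>2 \<le> N\<^sup>2" by (simp only: power2_eq_square d(2))
  qed (use N in simp)
  have Md: "M * d = sqrt (M * N)" "d / N = 1 / sqrt (M * N)"
  proof -
    show "M * d = sqrt (M * N)"
    proof (rule real_sqrt_unique[symmetric])
      have "(M * d)\<^sup>2 = M * M * (d * d)" by (simp add: power2_eq_square mult_ac)
      then show "(M * d)\<^sup>2 = M * N" using M by (simp add: d(2))
    qed (use M d in simp)
    then show "d / N = 1 / sqrt (M * N)"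
      using d M N by (simp flip: \<open>M * d = sqrt (M * N)\<close> add: field_simps)
  qed
  have cont: "continuous_on {p..q} ?f" if "N \<le> p" for p q
    using that N by (intro continuous_intros) auto
  have "integral {N..N + d} ?f + integral {N + d..B} ?f = integral {N..B} ?f"
    using d \<open>d \<le> N\<close> B by (intro Henstock_Kurzweil_Integration.integral_combine integrable_continuous_real cont) auto
  moreover have "norm (integral {N..N + d} ?f) \<le> (1 / N) * (N + d - N)"
  proof (rule integral_bound)
    show "norm (?f t) \<le> 1 / N" if "t \<in> {N..N + d}" for t
    proof -
      have "\<bar>sin (x / t + a * t)\<bar> / t \<le> 1 / N" using that N by (intro frac_le) auto
      then show ?thesis using that N by (simp add: abs_mult)
    qed
  qed (use d cont in auto)
  moreover have "\<bar>integral {N + d..B} ?f\<bar> \<le> 3 / (M * d)"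
  proof -
    \<comment> \<open>At \<open>N\<close> the derivative may vanish, namely for
      \<open>m = M\<close>; moving right by \<open>d \<le> N\<close> gains an amount linear in
      \<open>d\<close>.\<close>
    have low: "pi * (M * d) / N \<le> a - x / (N + d)\<^sup>2"
    proof -
      have "N\<^sup>2 / (N + d)\<^sup>2 \<le> 1 - d / (2 * N)"
      proof -
        have "(N + d)\<^sup>2 * (1 - d / (2 * N)) - N\<^sup>2 = d * (3 * N\<^sup>2 - d\<^sup>2) / (2 * N)"
          using N by (simp add: field_simps power2_eq_square)
        moreover have "d\<^sup>2 \<le> 3 * N\<^sup>2"
          using power_mono[of d N 2] d \<open>d \<le> N\<close> zero_le_power2[of N] by linarith
        then have "0 \<le> d * (3 * N\<^sup>2 - d\<^sup>2) / (2 * N)" using N d by simp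
        ultimately have "N\<^sup>2 \<le> (N + d)\<^sup>2 * (1 - d / (2 * N))" by linarith
        then show ?thesis using N d by (simp add: divide_le_eq mult.commute)
      qed
      then have "2 * pi * M * (N\<^sup>2 / (N + d)\<^sup>2) \<le> 2 * pi * M * (1 - d / (2 * N))"
        using M by (intro mult_left_mono) auto
      moreover have "2 * pi * M \<le> a" using mM by (simp add: a_def)
      moreover have "2 * pi * M * (1 - d / (2 * N)) = 2 * pi * M - pi * (M * d) / N"
        using N by (simp add: field_simps)
      ultimately show ?thesis by (simp add: x_def)
    qed
    have pos: "0 < pi * (M * d) / N" using M d N by simp
    have "\<bar>integral {N + d..B} ?f\<bar> \<le> 8 / ((N + d) * (a - x / (N + d)\<^sup>2))"
      by (rule abs_integral_plus_phase_le) (use pos low x N d \<open>d \<le> N\<close> B in auto)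
    also have "\<dots> \<le> 8 / (N * (pi * (M * d) / N))"
      using pos low N d by (intro divide_left_mono mult_mono mult_pos_pos) auto
    also have "\<dots> = (8 / pi) / (M * d)" using N by simp
    also have "\<dots> \<le> 3 / (M * d)"
      using M d pi_gt3 by (intro divide_right_mono) (auto simp: divide_le_eq)
    finally show ?thesis .
  qed
  ultimately have "\<bar>integral {N..B} ?f\<bar> \<le> 1 / sqrt (M * N) + 3 / sqrt (M * N)"
    using Md by simp
  then show ?thesis unfolding x_def a_def by simp
qed

text \<open>Translates the stationary phase amplitude \<open>sqrt (pi / l)\<close> into the form of
  the theorem.\<close>

lemma sqrt_pi_div_sqrt_eq_powr:
  assumes "0 < m" "0 < x"
  shows "sqrt (pi / sqrt (2 * pi * m * x)) = (pi / (2 * m * x)) powr (1 / 4)"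
proof -
  have "pi / sqrt (2 * pi * m * x) = sqrt (pi / (2 * m * x))"
  proof -
    have "pi / sqrt (2 * pi * m * x) = sqrt (pi\<^sup>2) / sqrt (2 * pi * m * x)" by simp
    also have "\<dots> = sqrt (pi\<^sup>2 / (2 * pi * m * x))" by (simp only: real_sqrt_divide)
    also have "pi\<^sup>2 / (2 * pi * m * x) = pi / (2 * m * x)" by (simp add: power2_eq_square)
    finally show ?thesis .
  qed
  also have "sqrt (sqrt (pi / (2 * m * x))) = ((pi / (2 * m * x)) powr (1 / 2)) powr (1 / 2)"
    using assms by (simp add: powr_half_sqrt)
  finally show ?thesis by (simp add: powr_powr)
qed

text \<open>The bounds differ only in the treatment of the end point \<open>N\<close>: the Fresnel integral is compared
  with its limit either by its decay or, when \<open>N\<close> is close to the stationary point, trivially.\<close>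

lemma stationary_phase_error_le:
  fixes m M N B :: real
  assumes m: "1 \<le> m" "m < M" and N: "1 \<le> N" "N \<le> B"
  defines "x \<equiv> 2 * pi * M * N\<^sup>2"
  assumes B: "4 * x \<le> B\<^sup>2"
  defines "E \<equiv> \<bar>integral {N..B} (\<lambda>t. 1 / t * sin (x / t + 2 * pi * m * t))
      - (pi / (2 * m * x)) powr (1 / 4) * sin (pi / 4 + 2 * sqrt (2 * pi * m * x))\<bar>"
  shows "E \<le> 5 / (m * N) + 2 / (N * (M - m))"
    and "M \<le> 2 * m \<Longrightarrow> E \<le> 3 / (m * N) + 5 / sqrt (M * N)"
proof -
  define a where "a = 2 * pi * m"
  define l where "l = sqrt (a * x)"
  define V where "V = sqrt (x / N) - sqrt (a * N)"
  define W where "W = sqrt (a * B) - sqrt (x / B)"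
  define e where "e u = \<bar>fresnel (2 * l) u - sqrt pi / 2 * sin (2 * l + pi / 4)\<bar>" for u
  have a: "0 < a" "2 * pi \<le> a" using m by (simp_all add: a_def)
  have x: "0 < x" using m N by (simp add: x_def)
  have l0: "0 < l" using a x by (simp add: l_def)
  have l1: "2 * pi * N * m \<le> l"
  proof -
    have "(2 * pi * N * m)\<^sup>2 = 2 * pi * m * (2 * pi * m * N\<^sup>2)" by (simp add: power2_eq_square)
    also have "\<dots> \<le> 2 * pi * m * (2 * pi * M * N\<^sup>2)" using m by (intro mult_left_mono mult_right_mono) auto
    finally have "(2 * pi * N * m)\<^sup>2 \<le> a * x" by (simp add: a_def x_def)
    then show ?thesis unfolding l_def by (rule real_le_rsqrt)
  qed
  have sl: "sqrt (2 * pi * N) * sqrt m \<le> sqrt l"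
    using l1 by (simp flip: real_sqrt_mult)
  have V_eq: "V = sqrt (2 * pi * N) * (sqrt M - sqrt m)"
  proof -
    have "x / N = 2 * pi * N * M" using N by (simp add: x_def power2_eq_square)
    moreover have "a * N = 2 * pi * N * m" by (simp add: a_def)
    ultimately show ?thesis
      by (simp only: V_def real_sqrt_mult[of "2 * pi * N"] right_diff_distrib)
  qed
  have V0: "0 < V" unfolding V_eq using m N by simp
  \<comment> \<open>\<open>4 * x \<le> B\<^sup>2\<close> puts \<open>B\<close> well beyond the
    stationary point \<open>sqrt (x / a)\<close>, so the far end point costs only
    \<open>2 / (m * N)\<close>.\<close>
  have W1: "sqrt (a * B) / 2 \<le> W"
  proof -
    have "x * 4 \<le> 1 * B\<^sup>2" using B by simp
    also have "\<dots> \<le> a * B\<^sup>2" using a pi_gt3 by (intro mult_right_mono) auto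
    finally have "x / B \<le> a * B / 4" using N by (simp add: field_simps power2_eq_square)
    then have "sqrt (x / B) \<le> sqrt (a * B / 4)" by simp
    also have "\<dots> = sqrt (a * B) / 2" by (simp add: real_sqrt_divide)
    finally show ?thesis by (simp add: W_def)
  qed
  have W0: "0 < W"
  proof -
    have "0 < sqrt (a * B) / 2" using a N by simp
    then show ?thesis using W1 by linarith
  qed
  have E: "E \<le> 2 / l + (e V + e W) / sqrt l"
    using integral_stationary_phase[OF a(1) x _ N(2), unfolded V_def[symmetric] W_def[symmetric] l_def[symmetric]]
      N V0 W0 sqrt_pi_div_sqrt_eq_powr[of m x] m x
    unfolding E_def e_def l_def a_def by (simp add: add.commute)
  have "2 / l \<le> 2 / (2 * pi * N * m)" using l1 l0 m N by (intro divide_left_mono) auto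
  also have "\<dots> \<le> 1 / (m * N)" using m N pi_gt3 by (simp add: field_simps)
  finally have E1: "2 / l \<le> 1 / (m * N)" .
  have "e W / sqrt l \<le> (4 / W) / sqrt l"
    unfolding e_def using fresnel_asymptotics[OF W0] l0 by (intro divide_right_mono) auto
  also have "\<dots> = 4 / (W * sqrt l)" by simp
  also have "\<dots> \<le> 4 / (pi * (m * N))"
  proof -
    have "pi * (m * N) = (sqrt (a * N) / 2) * (sqrt (2 * pi * N) * sqrt m)"
    proof -
      have "sqrt (a * N) = sqrt (2 * pi * N) * sqrt m"
        unfolding real_sqrt_mult[symmetric] by (simp add: a_def mult_ac)
      moreover have "(sqrt (2 * pi * N) * sqrt m) * (sqrt (2 * pi * N) * sqrt m) = 2 * pi * N * m"
        using m N real_sqrt_mult_self[of "2 * pi * N * m"] by (simp only: real_sqrt_mult[of "2 * pi * N" m]) simp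
      ultimately show ?thesis by simp
    qed
    also have "\<dots> \<le> W * sqrt l"
    proof (rule mult_mono)
      have "sqrt (a * N) / 2 \<le> sqrt (a * B) / 2" using a N by simp
      then show "sqrt (a * N) / 2 \<le> W" using W1 by linarith
    qed (use sl W0 m N in auto)
    finally show ?thesis using m N W0 l0 by (intro divide_left_mono) auto
  qed
  also have "\<dots> \<le> 2 / (m * N)" using m N pi_gt3 by (simp add: field_simps)
  finally have E2: "e W / sqrt l \<le> 2 / (m * N)" .
  show "E \<le> 5 / (m * N) + 2 / (N * (M - m))"
  proof -
    have "e V / sqrt l \<le> (4 / V) / sqrt l"
      unfolding e_def using fresnel_asymptotics[OF V0] l0 by (intro divide_right_mono) auto
    also have "\<dots> = 4 / (V * sqrt l)" by simp
    also have "\<dots> \<le> 4 / (pi * N * (m * (M - m) / M))"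
    proof -
      define p where "p = sqrt m"
      define q where "q = sqrt M"
      have pq: "0 < p" "p < q" "m = p * p" "M = q * q" using m by (simp_all add: p_def q_def)
      \<comment> \<open>This trades \<open>sqrt M - sqrt m\<close> for \<open>M - m\<close>, in a
        shape whose reciprocal splits into partial fractions:
        \<open>M / (m * (M - m)) = 1 / m + 1 / (M - m)\<close>.\<close>
      have key: "m * (M - m) / M \<le> 2 * (p * (q - p))"
      proof -
        have "m * (M - m) / M = p * (q - p) * (p * (q + p) / (q * q))"
          using pq by (simp add: field_simps)
        also have "\<dots> \<le> p * (q - p) * 2"
        proof (rule mult_left_mono)
          have "p * (q + p) \<le> q * (q + q)" using pq by (intro mult_mono) auto
          then show "p * (q + p) / (q * q) \<le> 2" using pq by (simp add: divide_le_eq algebra_simps)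
        qed (use pq in simp)
        finally show ?thesis by (simp add: mult_ac)
      qed
      have "pi * N * (m * (M - m) / M) \<le> pi * N * (2 * (p * (q - p)))"
        using key N by (intro mult_left_mono) auto
      also have "\<dots> = (sqrt (2 * pi * N) * (q - p)) * (sqrt (2 * pi * N) * p)"
      proof -
        have "sqrt (2 * pi * N) * sqrt (2 * pi * N) = 2 * pi * N" using N by simp
        then show ?thesis by (metis (no_types, opaque_lifting) mult.assoc mult.commute mult.left_commute)
      qed
      also have "\<dots> \<le> V * sqrt l"
        unfolding V_eq p_def q_def using sl m N by (intro mult_left_mono) auto
      finally show ?thesis using m N V0 l0 by (intro divide_left_mono) auto
    qed
    also have "\<dots> = (4 / pi) * (1 / (m * N) + 1 / (N * (M - m)))"
      using m N by (simp add: divide_simps)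
    also have "\<dots> \<le> 2 * (1 / (m * N) + 1 / (N * (M - m)))"
      using m N pi_gt3 by (intro mult_right_mono) (auto simp: divide_le_eq)
    finally have E3: "e V / sqrt l \<le> 2 / (m * N) + 2 / (N * (M - m))" by simp
    have "2 / l + (e V / sqrt l + e W / sqrt l) \<le> 1 / (m * N) + ((2 / (m * N) + 2 / (N * (M - m))) + 2 / (m * N))"
      by (rule add_mono[OF E1 add_mono[OF E3 E2]])
    also have "\<dots> = 5 / (m * N) + 2 / (N * (M - m))" by simp
    finally show ?thesis using E unfolding add_divide_distrib by (rule order_trans[rotated])
  qed
  show "E \<le> 3 / (m * N) + 5 / sqrt (M * N)" if Mm: "M \<le> 2 * m"
  proof -
    have "M * N \<le> 2 * pi * N * m"
    proof -
      have "M * N \<le> (2 * m) * N" using Mm N by (intro mult_right_mono) auto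
      also have "\<dots> \<le> (2 * m * N) * pi" using m N pi_gt3 by simp
      finally show ?thesis by (simp add: mult_ac)
    qed
    then have MNl: "sqrt (M * N) \<le> sqrt l" using l1 by simp
    have "e V / sqrt l \<le> 5 / sqrt l"
      unfolding e_def using V0 l0 by (intro divide_right_mono fresnel_minus_limit_le_5) auto
    also have "\<dots> \<le> 5 / sqrt (M * N)"
      using MNl m N l0 by (intro divide_left_mono) auto
    finally have E3: "e V / sqrt l \<le> 5 / sqrt (M * N)" .
    have "2 / l + (e V / sqrt l + e W / sqrt l) \<le> 1 / (m * N) + (5 / sqrt (M * N) + 2 / (m * N))"
      by (rule add_mono[OF E1 add_mono[OF E3 E2]])
    also have "\<dots> = 3 / (m * N) + 5 / sqrt (M * N)" by simp
    finally show ?thesis using E unfolding add_divide_distrib by (rule order_trans[rotated])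
  qed
qed

section \<open>The sine integral, the tail of the series and sums over frequencies\<close>

lemma Si_0 [simp]: "Si 0 = 0"
  using Si_neg[of 0] by simp

lemma abs_Si_le:
  assumes "0 \<le> u"
  shows "\<bar>Si u\<bar> \<le> u"
proof (cases "u = 0")
  case False
  then have "0 < u" using assms by simp
  then obtain z where "Si u - Si 0 = (u - 0) * sinc z"
    using MVT2[of 0 u Si sinc] DERIV_Si by blast
  moreover have "\<bar>sinc z\<bar> \<le> 1"
    using abs_sin_x_le_abs_x[of z] by (simp add: divide_le_eq)
  then have "u * \<bar>sinc z\<bar> \<le> u * 1" using assms by (intro mult_left_mono) auto
  ultimately show ?thesis using assms by (simp only: abs_mult diff_zero Si_0 abs_of_nonneg mult_1_right)
qed simp

lemma abs_Si_minus_pi_half_le: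
  assumes T: "0 < T"
  shows "\<bar>Si T - pi / 2\<bar> \<le> 8 / T"
proof (rule tendsto_upperbound)
  show "((\<lambda>S. \<bar>Si T - Si S\<bar>) \<longlongrightarrow> \<bar>Si T - pi / 2\<bar>) at_top"
    by (intro tendsto_intros Si_at_top)
  show "\<forall>\<^sub>F S in at_top. \<bar>Si T - Si S\<bar> \<le> 8 / T"
    using eventually_ge_at_top[of T]
  proof eventually_elim
    case (elim S)
    have "((\<lambda>u. 1 / u * sin u) has_integral Si S - Si T) {T..S}"
    proof (rule fundamental_theorem_of_calculus)
      fix u assume "u \<in> {T..S}"
      then have "sinc u = 1 / u * sin u" using T by simp
      then show "(Si has_vector_derivative 1 / u * sin u) (at u within {T..S})"
        using DERIV_Si[of u] has_field_derivative_at_within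
        by (metis has_real_derivative_iff_has_vector_derivative)
    qed fact
    moreover have "\<bar>integral {T..S} (\<lambda>u. 1 / u * sin u)\<bar> \<le> 8 * (1 / T) / 1"
      by (rule van_der_corput_sin[where \<phi> = "\<lambda>u. u" and \<phi>' = "\<lambda>u. 1"])
        (use T elim antimono_on_inverse_pos in \<open>auto simp: monotone_on_def\<close>)
    ultimately show ?case by (simp add: has_integral_iff abs_minus_commute)
  qed
qed simp

text \<open>A primitive is \<open>- Si (x / t)\<close>: at \<open>N\<close> the argument is large
  and \<open>Si\<close> is close to \<open>pi / 2\<close>, at \<open>B\<close> it is small and
  \<open>Si\<close> is close to 0.\<close>

lemma integral_sin_div_minus_pi_half_le:
  fixes x N B :: real
  assumes x: "0 < x" and N: "0 < N" "N \<le> B"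
  shows "\<bar>integral {N..B} (\<lambda>t. 1 / t * sin (x / t)) - pi / 2\<bar> \<le> 8 * N / x + x / B"
proof -
  have "((\<lambda>t. 1 / t * sin (x / t)) has_integral (- Si (x / B)) - (- Si (x / N))) {N..B}"
  proof (rule fundamental_theorem_of_calculus)
    fix t assume "t \<in> {N..B}"
    then have t: "0 < t" using N by auto
    have "((\<lambda>t. x / t) has_real_derivative - (x / (t * t))) (at t within {N..B})"
      using t by (auto intro!: derivative_eq_intros)
    then have "((\<lambda>t. - Si (x / t)) has_real_derivative - (sinc (x / t) * - (x / (t * t)))) (at t within {N..B})"
      by (intro DERIV_minus DERIV_chain2[OF DERIV_Si])
    moreover have "- (sinc (x / t) * - (x / (t * t))) = 1 / t * sin (x / t)"
      using t x by simp
    ultimately show "((\<lambda>t. - Si (x / t)) has_vector_derivative 1 / t * sin (x / t)) (at t within {N..B})"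
      unfolding has_real_derivative_iff_has_vector_derivative[symmetric] by (simp only:)
  qed (use N in simp)
  then have "integral {N..B} (\<lambda>t. 1 / t * sin (x / t)) = Si (x / N) - Si (x / B)"
    by (simp add: has_integral_iff)
  moreover have "\<bar>Si (x / N) - pi / 2\<bar> \<le> 8 * N / x"
    using abs_Si_minus_pi_half_le[of "x / N"] x N by simp
  moreover have "\<bar>Si (x / B)\<bar> \<le> x / B"
    using x N by (intro abs_Si_le) auto
  ultimately show ?thesis by linarith
qed

text \<open>\<open>\<bar>sin u\<bar> \<le> u\<close> bounds the term at \<open>n\<close> by
  \<open>x / n\<^sup>2\<close>, hence by \<open>x / (n - 1) - x / n\<close>, and this telescopes to
  \<open>x / B\<close>. The shifted index of \<open>HL_Q\<close> makes \<open>a (i + B)\<close> the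
  term at \<open>n = i + B + 1\<close>.\<close>

lemma abs_HL_Q_tail_le:
  assumes x: "0 \<le> x" and B: "1 \<le> B"
  shows "\<bar>HL_Q x - (\<Sum>n = 1..B. 1 / real n * sin (x / real n))\<bar> \<le> x / real B"
proof -
  define a where "a n = 1 / real (Suc n) * sin (x / real (Suc n))" for n
  define g where "g i = x / real (i + B) - x / real (Suc i + B)" for i
  have "(\<lambda>i. x / real (i + B)) \<longlonglongrightarrow> 0"
    using LIMSEQ_ignore_initial_segment[OF lim_const_over_n[of x], of B] by simp
  from telescope_sums'[OF this] have g: "g sums (x / real B)"
    by (simp add: g_def[abs_def])
  have ag: "norm (a (i + B)) \<le> g i" for i
  proof -
    define y where "y = real (i + B)"
    have y: "y \<ge> 1" using B by (simp add: y_def)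
    have "\<bar>sin (x / (y + 1))\<bar> \<le> x / (y + 1)"
      using abs_sin_x_le_abs_x[of "x / (y + 1)"] x y by simp
    then have "\<bar>1 / (y + 1) * sin (x / (y + 1))\<bar> \<le> 1 / (y + 1) * (x / (y + 1))"
      unfolding abs_mult using y by (intro mult_mono) auto
    also have "\<dots> \<le> 1 / y * (x / (y + 1))"
    proof (rule mult_right_mono)
      show "1 / (y + 1) \<le> 1 / y" using y by (intro frac_le) auto
    qed (use x y in simp)
    also have "\<dots> = x / y - x / (y + 1)" using y by (simp add: field_simps)
    finally show ?thesis by (simp add: a_def g_def y_def add_ac)
  qed
  have "summable g" using g by (rule sums_summable)
  then have "summable (\<lambda>i. a (i + B))"
    using ag by (rule summable_comparison_test'[where N = 0])
  then have "summable a" by (simp only: summable_iff_shift)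
  then have "suminf a = (\<Sum>i. a (i + B)) + (\<Sum>i<B. a i)"
    by (rule suminf_split_initial_segment)
  moreover have "HL_Q x = suminf a" by (simp only: HL_Q_def a_def[abs_def])
  moreover have "(\<Sum>i<B. a i) = (\<Sum>n = 1..B. 1 / real n * sin (x / real n))"
    unfolding a_def by (rule sum.reindex_bij_witness[of _ "\<lambda>n. n - 1" Suc]) auto
  moreover have "norm (\<Sum>i. a (i + B)) \<le> suminf g"
    using ag \<open>summable g\<close> by (rule norm_suminf_le)
  moreover have "suminf g = x / real B" using g by (rule sums_unique[symmetric])
  ultimately show ?thesis by simp
qed

section \<open>Sums over the frequencies\<close>

lemma harm_le_1_plus_ln:
  assumes "1 \<le> n"
  shows "harm n \<le> 1 + ln (real n)"
proof -
  obtain k where k: "n = Suc k" using assms by (cases n) auto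
  have "harm (Suc k) - ln (real (Suc k)) \<le> harm (Suc 0) - ln (real (Suc 0))"
    using decseq_harm_diff_ln by (rule decseqD) simp
  then show ?thesis by (simp add: k harm_expand)
qed

text \<open>Replacing \<open>M\<close> by its integer part \<open>p\<close> at most doubles a
  distance that is at least 1. The integers on either side of \<open>p\<close> then give a harmonic
  sum each, so the constant is 2 * 2.\<close>

lemma sum_inverse_dist_le_harm:
  fixes M :: real
  assumes M: "1 \<le> M" "M \<le> real K"
  shows "(\<Sum>m | m \<in> {1..K} \<and> 1 \<le> \<bar>real m - M\<bar>. 1 / \<bar>real m - M\<bar>) \<le> 4 * harm K"
proof -
  define p where "p = nat \<lfloor>M\<rfloor>"
  have p: "1 \<le> p" "real p \<le> M" "M < real p + 1" "p \<le> K"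
    unfolding p_def using M by linarith+
  have h: "(harm K :: real) = (\<Sum>j = 1..K. 1 / real j)"
    by (simp add: harm_def inverse_eq_divide)
  \<comment> \<open>For \<open>j \<ge> p\<close> the truncated difference \<open>p - j\<close> is 0,
    outside the range of \<open>m\<close>; such \<open>j\<close> only add nonnegative terms.\<close>
  have low: "(\<Sum>m = 1..<p. 1 / real (p - m)) \<le> (\<Sum>j = 1..K. 1 / real j)"
  proof (rule sum_le_included[where i = "\<lambda>j. p - j"])
    show "\<forall>m\<in>{1..<p}. \<exists>j\<in>{1..K}. p - j = m \<and> 1 / real (p - m) \<le> 1 / real j"
    proof
      fix m assume "m \<in> {1..<p}"
      then show "\<exists>j\<in>{1..K}. p - j = m \<and> 1 / real (p - m) \<le> 1 / real j"
        using p by (intro bexI[of _ "p - m"]) auto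
    qed
  qed auto
  have high: "(\<Sum>m = p + 1..K. 1 / real (m - p)) \<le> (\<Sum>j = 1..K. 1 / real j)"
  proof (rule sum_le_included[where i = "\<lambda>j. j + p"])
    show "\<forall>m\<in>{p + 1..K}. \<exists>j\<in>{1..K}. j + p = m \<and> 1 / real (m - p) \<le> 1 / real j"
    proof
      fix m assume "m \<in> {p + 1..K}"
      then show "\<exists>j\<in>{1..K}. j + p = m \<and> 1 / real (m - p) \<le> 1 / real j"
        using p by (intro bexI[of _ "m - p"]) auto
    qed
  qed auto
  let ?S = "{m. m \<in> {1..K} \<and> 1 \<le> \<bar>real m - M\<bar>}"
  have "(\<Sum>m\<in>?S. 1 / \<bar>real m - M\<bar>) \<le> (\<Sum>m\<in>?S. 2 / \<bar>real m - real p\<bar>)"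
  proof (rule sum_mono)
    fix m assume m: "m \<in> ?S"
    have *: "u \<le> 2 * v" if "1 \<le> v" "w \<le> 1" "u \<le> v + w" for u v w :: real
      using that by linarith
    have ge1: "1 \<le> \<bar>real m - M\<bar>" using m by simp
    moreover have "\<bar>M - real p\<bar> \<le> 1" using p by simp
    moreover have "\<bar>real m - real p\<bar> \<le> \<bar>real m - M\<bar> + \<bar>M - real p\<bar>"
      using abs_triangle_ineq[of "real m - M" "M - real p"] by simp
    ultimately have "\<bar>real m - real p\<bar> \<le> 2 * \<bar>real m - M\<bar>" by (rule *)
    moreover have "m \<noteq> p" using m p by auto
    ultimately have "2 / (2 * \<bar>real m - M\<bar>) \<le> 2 / \<bar>real m - real p\<bar>"
      using ge1 by (intro divide_left_mono) auto
    then show "1 / \<bar>real m - M\<bar> \<le> 2 / \<bar>real m - real p\<bar>" by simp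
  qed
  also have "\<dots> \<le> (\<Sum>m\<in>{1..<p} \<union> {p + 1..K}. 2 / \<bar>real m - real p\<bar>)"
  proof (rule sum_mono2)
    have "m \<noteq> p" if "m \<in> ?S" for m using that p by auto
    then show "?S \<subseteq> {1..<p} \<union> {p + 1..K}" by fastforce
  qed auto
  also have "\<dots> = (\<Sum>m = 1..<p. 2 / \<bar>real m - real p\<bar>) + (\<Sum>m = p + 1..K. 2 / \<bar>real m - real p\<bar>)"
    by (rule sum.union_disjoint) auto
  also have "(\<Sum>m = 1..<p. 2 / \<bar>real m - real p\<bar>) = 2 * (\<Sum>m = 1..<p. 1 / real (p - m))"
    unfolding sum_distrib_left by (intro sum.cong) (auto simp: of_nat_diff)
  also have "(\<Sum>m = p + 1..K. 2 / \<bar>real m - real p\<bar>) = 2 * (\<Sum>m = p + 1..K. 1 / real (m - p))"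
    unfolding sum_distrib_left by (intro sum.cong) (auto simp: of_nat_diff)
  finally show ?thesis using low high h by linarith
qed

lemma card_nat_near_le_2:
  fixes M :: real
  assumes "0 \<le> M"
  shows "card {m \<in> {1..K}. \<bar>real m - M\<bar> < 1} \<le> 2"
proof -
  define p where "p = nat \<lfloor>M\<rfloor>"
  have p: "real p \<le> M" "M < real p + 1"
    unfolding p_def using assms by linarith+
  have "{m \<in> {1..K}. \<bar>real m - M\<bar> < 1} \<subseteq> {p, p + 1}"
  proof
    fix m assume "m \<in> {m \<in> {1..K}. \<bar>real m - M\<bar> < 1}"
    then have "\<bar>real m - M\<bar> < 1" by simp
    then have "real m < real (p + 2)" "real p < real (m + 1)" using p by (simp; linarith)+
    then show "m \<in> {p, p + 1}" by (simp only: of_nat_less_iff) auto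
  qed
  then have "card {m \<in> {1..K}. \<bar>real m - M\<bar> < 1} \<le> card {p, p + 1}"
    by (intro card_mono) auto
  also have "\<dots> \<le> 2" by simp
  finally show ?thesis .
qed

text \<open>One right-hand side for all positions of \<open>m\<close>, ready for summation. In
  \<open>7 / (real m * N)\<close>, 2 is the share of the phase with the minus sign and 5 covers the
  other phase.\<close>

lemma phase_error_le:
  fixes M N B :: real and m :: nat
  assumes m: "1 \<le> m" and M: "1 \<le> M" and N: "1 \<le> N"
  defines "x \<equiv> 2 * pi * M * N\<^sup>2"
  assumes B: "2 * N \<le> B" "4 * x \<le> B\<^sup>2"
  shows "\<bar>integral {N..B} (\<lambda>t. 1 / t * sin (x / t + 2 * pi * real m * t))
      + integral {N..B} (\<lambda>t. 1 / t * sin (x / t - 2 * pi * real m * t))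
      - (if real m < M then (pi / (2 * real m * x)) powr (1 / 4)
          * sin (pi / 4 + 2 * sqrt (2 * pi * real m * x)) else 0)\<bar>
    \<le> 7 / (real m * N) + (if 1 \<le> \<bar>real m - M\<bar> then 2 / (N * \<bar>real m - M\<bar>) else 5 / sqrt (M * N))"
proof -
  define P where "P = integral {N..B} (\<lambda>t. 1 / t * sin (x / t + 2 * pi * real m * t))"
  define R where "R = integral {N..B} (\<lambda>t. 1 / t * sin (x / t - 2 * pi * real m * t))"
  define g where "g = (pi / (2 * real m * x)) powr (1 / 4) * sin (pi / 4 + 2 * sqrt (2 * pi * real m * x))"
  have x: "0 < x" using M N by (simp add: x_def)
  have "\<bar>R\<bar> \<le> 8 / (N * (2 * pi * real m))"
    unfolding R_def by (rule abs_integral_minus_phase_le) (use m N B x in auto)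
  also have "\<dots> \<le> 2 / (real m * N)"
    using m N pi_gt3 by (simp add: divide_simps)
  finally have R: "\<bar>R\<bar> \<le> 2 / (real m * N)" .
  have split: "7 / (real m * N) = 5 / (real m * N) + 2 / (real m * N)"
    by (simp add: add_divide_distrib[symmetric])
  have comb: "\<bar>p + r - h\<bar> \<le> (u + v) + w" if "\<bar>p - h\<bar> \<le> u + w" "\<bar>r\<bar> \<le> v" for p r h u v w :: real
    using that by linarith
  consider "real m < M" "1 \<le> M - real m" | "real m < M" "M - real m < 1"
    | "M \<le> real m" "1 \<le> real m - M" | "M \<le> real m" "real m - M < 1" by linarith
  then show ?thesis
    unfolding P_def[symmetric] R_def[symmetric] g_def[symmetric] split
  proof cases
    case 1
    have c: "1 \<le> \<bar>real m - M\<bar>" "\<bar>real m - M\<bar> = M - real m" using 1 by auto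
    have "\<bar>P - g\<bar> \<le> 5 / (real m * N) + 2 / (N * (M - real m))"
      unfolding P_def g_def x_def using m N B 1 by (intro stationary_phase_error_le(1)) (auto simp: x_def)
    then show "\<bar>P + R - (if real m < M then g else 0)\<bar> \<le> 5 / (real m * N) + 2 / (real m * N)
        + (if 1 \<le> \<bar>real m - M\<bar> then 2 / (N * \<bar>real m - M\<bar>) else 5 / sqrt (M * N))"
      unfolding if_P[OF 1(1)] if_P[OF c(1)] unfolding c(2) by (rule comb[OF _ R])
  next
    case 2
    have c: "\<not> 1 \<le> \<bar>real m - M\<bar>" using 2 by auto
    \<comment> \<open>Here \<open>M < m + 1 \<le> 2 * m\<close>, as the second estimate
      demands.\<close>
    have "\<bar>P - g\<bar> \<le> 3 / (real m * N) + 5 / sqrt (M * N)"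
      unfolding P_def g_def x_def using m N B 2 by (intro stationary_phase_error_le(2)) (auto simp: x_def)
    also have "\<dots> \<le> 5 / (real m * N) + 5 / sqrt (M * N)"
      using N by (intro add_right_mono divide_right_mono) auto
    finally show "\<bar>P + R - (if real m < M then g else 0)\<bar> \<le> 5 / (real m * N) + 2 / (real m * N)
        + (if 1 \<le> \<bar>real m - M\<bar> then 2 / (N * \<bar>real m - M\<bar>) else 5 / sqrt (M * N))"
      unfolding if_P[OF 2(1)] if_not_P[OF c] by (rule comb[OF _ R])
  next
    case 3
    have n: "\<not> real m < M" using 3 by auto
    have c: "1 \<le> \<bar>real m - M\<bar>" "\<bar>real m - M\<bar> = real m - M" using 3 by auto
    have xN: "x / N\<^sup>2 = 2 * pi * M" using N by (simp add: x_def)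
    have "\<bar>P\<bar> \<le> 8 / (N * (2 * pi * real m - x / N\<^sup>2))"
      unfolding P_def by (rule abs_integral_plus_phase_le) (use 3 N B x xN in auto)
    also have "2 * pi * real m - x / N\<^sup>2 = 2 * pi * (real m - M)" by (simp add: xN right_diff_distrib)
    also have "8 / (N * (2 * pi * (real m - M))) = (4 / pi) / (N * (real m - M))" by simp
    also have "\<dots> \<le> 2 / (N * (real m - M))"
      using 3 N pi_gt3 by (intro divide_right_mono) (auto simp: divide_le_eq)
    also have "\<dots> \<le> 5 / (real m * N) + 2 / (N * (real m - M))" using N by simp
    finally have "\<bar>P - 0\<bar> \<le> 5 / (real m * N) + 2 / (N * (real m - M))" by simp
    then show "\<bar>P + R - (if real m < M then g else 0)\<bar> \<le> 5 / (real m * N) + 2 / (real m * N)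
        + (if 1 \<le> \<bar>real m - M\<bar> then 2 / (N * \<bar>real m - M\<bar>) else 5 / sqrt (M * N))"
      unfolding if_not_P[OF n] if_P[OF c(1)] unfolding c(2) by (rule comb[OF _ R])
  next
    case 4
    have n: "\<not> real m < M" and c: "\<not> 1 \<le> \<bar>real m - M\<bar>" using 4 by auto
    have "\<bar>P\<bar> \<le> 4 / sqrt (M * N)"
      unfolding P_def x_def using M N B 4 by (intro abs_integral_plus_phase_transitional_le) auto
    also have "\<dots> \<le> 5 / sqrt (M * N)" using M N by (intro divide_right_mono) auto
    also have "\<dots> \<le> 5 / (real m * N) + 5 / sqrt (M * N)" using N by simp
    finally have "\<bar>P - 0\<bar> \<le> 5 / (real m * N) + 5 / sqrt (M * N)" by simp
    then show "\<bar>P + R - (if real m < M then g else 0)\<bar> \<le> 5 / (real m * N) + 2 / (real m * N)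
        + (if 1 \<le> \<bar>real m - M\<bar> then 2 / (N * \<bar>real m - M\<bar>) else 5 / sqrt (M * N))"
      unfolding if_not_P[OF n] if_not_P[OF c] by (rule comb[OF _ R])
  qed
qed

text \<open>The constants are 15 = 7 + 2 * 4, from the harmonic sum and the sum over distances, and
  10 = 2 * 5, from at most two exceptional frequencies.\<close>

lemma sum_phase_error_le:
  fixes M N :: real
  assumes M: "1 \<le> M" "M \<le> real K" and N: "1 \<le> N"
  shows "(\<Sum>m = 1..K. 7 / (real m * N) + (if 1 \<le> \<bar>real m - M\<bar> then 2 / (N * \<bar>real m - M\<bar>) else 5 / sqrt (M * N)))
    \<le> 15 * harm K / N + 10 / sqrt (M * N)"
proof -
  define h where "h = harm K / N"
  have comb: "u + v \<le> 15 * h + 10 / sqrt (M * N)"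
    if "u = 7 * h" "v = p + q" "p \<le> 8 * h" "q \<le> 2 * (5 / sqrt (M * N))" for u v p q
    using that by simp
  have "(\<Sum>m = 1..K. 7 / (real m * N)) = 7 * h"
    unfolding h_def harm_def sum_distrib_left sum_divide_distrib by (intro sum.cong) (auto simp: field_simps)
  moreover have "(\<Sum>m = 1..K. if 1 \<le> \<bar>real m - M\<bar> then 2 / (N * \<bar>real m - M\<bar>) else 5 / sqrt (M * N))
      = (\<Sum>m | m \<in> {1..K} \<and> 1 \<le> \<bar>real m - M\<bar>. 2 / (N * \<bar>real m - M\<bar>))
        + (\<Sum>m | m \<in> {1..K} \<and> \<not> 1 \<le> \<bar>real m - M\<bar>. 5 / sqrt (M * N))"
    by (subst sum.If_cases) (auto simp: Int_def)
  moreover have "(\<Sum>m | m \<in> {1..K} \<and> 1 \<le> \<bar>real m - M\<bar>. 2 / (N * \<bar>real m - M\<bar>)) \<le> 8 * h"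
  proof -
    have "(\<Sum>m | m \<in> {1..K} \<and> 1 \<le> \<bar>real m - M\<bar>. 2 / (N * \<bar>real m - M\<bar>))
        = 2 / N * (\<Sum>m | m \<in> {1..K} \<and> 1 \<le> \<bar>real m - M\<bar>. 1 / \<bar>real m - M\<bar>)"
      unfolding sum_distrib_left by (intro sum.cong) auto
    also have "\<dots> \<le> 2 / N * (4 * harm K)"
      using sum_inverse_dist_le_harm[OF M] N by (intro mult_left_mono) auto
    finally show ?thesis by (simp add: h_def)
  qed
  moreover have "(\<Sum>m | m \<in> {1..K} \<and> \<not> 1 \<le> \<bar>real m - M\<bar>. 5 / sqrt (M * N)) \<le> 2 * (5 / sqrt (M * N))"
  proof -
    have "card {m. m \<in> {1..K} \<and> \<not> 1 \<le> \<bar>real m - M\<bar>} \<le> 2"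
      using card_nat_near_le_2[of M K] M by (simp add: not_le)
    then have "real (card {m. m \<in> {1..K} \<and> \<not> 1 \<le> \<bar>real m - M\<bar>}) * (5 / sqrt (M * N)) \<le> 2 * (5 / sqrt (M * N))"
      using M N by (intro mult_right_mono) auto
    then show ?thesis by (simp only: sum_constant)
  qed
  ultimately show ?thesis
    unfolding sum.distrib h_def times_divide_eq_right[symmetric] by (rule comb[unfolded h_def])
qed

section \<open>The summand \<open>sin (x / t) / t\<close> and its frequencies\<close>

lemma sin_div_deriv:
  fixes x t :: real
  assumes "t \<noteq> 0"
  shows "((\<lambda>t. 1 / t * sin (x / t)) has_real_derivative - (1 / t\<^sup>2) * sin (x / t) - x / t ^ 3 * cos (x / t)) (at t)"
  using assms by (auto intro!: derivative_eq_intros simp: field_simps power2_eq_square power3_eq_cube)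

lemma abs_sin_div_deriv_le:
  fixes x t :: real
  assumes x: "1 \<le> x" and t: "1 \<le> t"
  shows "\<bar>- (1 / t\<^sup>2) * sin (x / t) - x / t ^ 3 * cos (x / t)\<bar> \<le> 2 * x"
proof -
  have "\<bar>- (1 / t\<^sup>2) * sin (x / t)\<bar> \<le> 1 * 1"
    unfolding abs_mult using t by (intro mult_mono) (auto simp: divide_le_eq)
  moreover have "\<bar>x / t ^ 3 * cos (x / t)\<bar> \<le> x * 1"
    unfolding abs_mult
  proof (intro mult_mono)
    have "x / t ^ 3 \<le> x / 1" using x t by (intro divide_left_mono) auto
    then show "\<bar>x / t ^ 3\<bar> \<le> x" using x t by simp
  qed (use x in auto)
  ultimately have "\<bar>- (1 / t\<^sup>2) * sin (x / t) - x / t ^ 3 * cos (x / t)\<bar> \<le> 1 * 1 + x * 1"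
    by (rule order_trans[OF abs_triangle_ineq4 add_mono])
  then show ?thesis using x by simp
qed

lemma integral_dirichlet_kernel_sin_div:
  fixes x N B :: real
  assumes N: "0 < N"
  shows "integral {N..B} (\<lambda>t. 1 / t * sin (x / t) * dirichlet_kernel K t)
    = integral {N..B} (\<lambda>t. 1 / t * sin (x / t))
      + (\<Sum>m = 1..K. integral {N..B} (\<lambda>t. 1 / t * sin (x / t + 2 * pi * real m * t))
          + integral {N..B} (\<lambda>t. 1 / t * sin (x / t - 2 * pi * real m * t)))"
proof -
  have int: "(\<lambda>t. 1 / t * sin (x / t)) integrable_on {N..B}"
    "(\<lambda>t. 1 / t * sin (x / t + 2 * pi * real m * t)) integrable_on {N..B}"
    "(\<lambda>t. 1 / t * sin (x / t - 2 * pi * real m * t)) integrable_on {N..B}" for m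
    using N by (intro integrable_continuous_real continuous_intros; auto)+
  have "1 / t * sin (x / t) * dirichlet_kernel K t = 1 / t * sin (x / t)
      + (\<Sum>m = 1..K. 1 / t * sin (x / t + 2 * pi * real m * t) + 1 / t * sin (x / t - 2 * pi * real m * t))" for t
  proof -
    have "1 / t * sin (x / t) * (2 * cos (2 * pi * real m * t))
        = 1 / t * sin (x / t + 2 * pi * real m * t) + 1 / t * sin (x / t - 2 * pi * real m * t)" for m
      by (simp only: sin_add sin_diff) (simp add: algebra_simps)
    then show ?thesis
      by (simp only: dirichlet_kernel_def sum_distrib_left distrib_left mult_1_right)
  qed
  then have "integral {N..B} (\<lambda>t. 1 / t * sin (x / t) * dirichlet_kernel K t)
      = integral {N..B} (\<lambda>t. 1 / t * sin (x / t)
        + (\<Sum>m = 1..K. 1 / t * sin (x / t + 2 * pi * real m * t) + 1 / t * sin (x / t - 2 * pi * real m * t)))"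
    by (simp only:)
  also have "\<dots> = integral {N..B} (\<lambda>t. 1 / t * sin (x / t)) + integral {N..B} (\<lambda>t.
      \<Sum>m = 1..K. 1 / t * sin (x / t + 2 * pi * real m * t) + 1 / t * sin (x / t - 2 * pi * real m * t))"
    by (intro integral_add int integrable_sum integrable_add) auto
  also have "integral {N..B} (\<lambda>t. \<Sum>m = 1..K. 1 / t * sin (x / t + 2 * pi * real m * t) + 1 / t * sin (x / t - 2 * pi * real m * t))
      = (\<Sum>m = 1..K. integral {N..B} (\<lambda>t. 1 / t * sin (x / t + 2 * pi * real m * t) + 1 / t * sin (x / t - 2 * pi * real m * t)))"
    by (intro integral_sum int integrable_add) auto
  also have "\<dots> = (\<Sum>m = 1..K. integral {N..B} (\<lambda>t. 1 / t * sin (x / t + 2 * pi * real m * t))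
          + integral {N..B} (\<lambda>t. 1 / t * sin (x / t - 2 * pi * real m * t)))"
    by (intro sum.cong refl integral_add int)
  finally show ?thesis .
qed

section \<open>The approximate formula\<close>

lemma HL_Q_approx:
  fixes M N x :: real
  assumes M: "1 \<le> M" and N: "1 \<le> N" and x_eq: "2 * pi * M * N\<^sup>2 = x"
  shows "\<bar>HL_Q x - (\<Sum>n | 1 \<le> n \<and> real n < N. 1 / real n * sin (x / real n)) - pi / 2
      - (\<Sum>m | 1 \<le> m \<and> real m < M.
          (pi / (2 * real m * x)) powr (1 / 4) * sin (pi / 4 + 2 * sqrt (2 * pi * real m * x)))\<bar>
    \<le> 716 * (ln x / N) + 10 / sqrt (M * N)"
proof -
  define f where "f t = 1 / t * sin (x / t)" for t :: real
  define g where "g m = (pi / (2 * real m * x)) powr (1 / 4) * sin (pi / 4 + 2 * sqrt (2 * pi * real m * x))" for m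
  have N2: "N \<le> N\<^sup>2" using N by (simp add: power2_eq_square)
  have x6: "6 * (M * N\<^sup>2) \<le> x"
    unfolding x_eq[symmetric] using M pi_gt3 by (simp add: mult_right_mono)
  have "1 * N\<^sup>2 \<le> M * N\<^sup>2" "M * 1 \<le> M * N\<^sup>2"
    using M N N2 by (intro mult_right_mono mult_left_mono; simp)+
  then have xN2: "6 * N\<^sup>2 \<le> x" and xM: "6 * M \<le> x" using x6 by linarith+
  have xN: "6 * N \<le> x" and x_ge: "6 \<le> x" using xN2 N2 N by linarith+
  have xx: "x \<le> x\<^sup>2" using x_ge by (simp add: power2_eq_square)
  \<comment> \<open>Of order \<open>x\<^sup>2\<close> so that \<open>x * N \<le> B\<close>: the tail
    of the series and the sine integral at \<open>B\<close> then cost at most \<open>1 / N\<close>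
    each.\<close>
  define B where "B = nat \<lceil>9 * x\<^sup>2\<rceil>"
  have B: "9 * x\<^sup>2 \<le> real B" "real B \<le> 10 * x\<^sup>2"
    unfolding B_def using xx x_ge by linarith+
  have B2: "2 * N \<le> real B" "4 * x \<le> real B" "1 \<le> real B"
    using B xx xN N by linarith+
  have "4 * x \<le> (real B)\<^sup>2"
    using B2 self_le_power[of "real B" 2] by linarith
  \<comment> \<open>The summation error is of order \<open>B * x / k\<close>, that is
    \<open>x ^ 3 / k\<close>; the fourth power brings it down to order \<open>1 / x\<close>.\<close>
  define k where "k = nat \<lceil>x ^ 4\<rceil>"
  have x4: "x\<^sup>2 \<le> x ^ 4" using x_ge by (intro power_increasing) auto
  have k: "x ^ 4 \<le> real k" "real k \<le> 2 * x ^ 4"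
    unfolding k_def using xx x4 x_ge by linarith+
  have k1: "1 \<le> real k" using k xx x4 x_ge by linarith
  define K where "K = k\<^sup>2"
  \<comment> \<open>\<open>M \<le> real K\<close> ensures that all main terms occur among the first
    \<open>K\<close> frequencies.\<close>
  have K: "1 \<le> K" "M \<le> real K"
  proof -
    show "1 \<le> K" using k1 by (simp add: K_def)
    have "real k \<le> real K" using k1 self_le_power[of "real k" 2] by (simp add: K_def)
    moreover have "M \<le> real k" using k xx x4 xM M by linarith
    ultimately show "M \<le> real K" by simp
  qed

  have 1: "\<bar>HL_Q x - (\<Sum>n = 1..B. f (real n))\<bar> \<le> 1 / N"
  proof -
    have "\<bar>HL_Q x - (\<Sum>n = 1..B. f (real n))\<bar> \<le> x / real B"
      unfolding f_def using x_ge B2 by (intro abs_HL_Q_tail_le) auto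
    also have "\<dots> \<le> x / (x * N)"
    proof (rule divide_left_mono)
      have "x * N \<le> x * x" using xN N x_ge by (intro mult_left_mono) auto
      then show "x * N \<le> real B" using B(1) by (simp add: power2_eq_square)
    qed (use x_ge N B2 in auto)
    finally show ?thesis using x_ge by simp
  qed

  have 2: "\<bar>(\<Sum>n | N \<le> real n \<and> n \<le> B. f (real n)) - integral {N..real B} (\<lambda>t. f t * dirichlet_kernel K t)\<bar> \<le> 541 / N"
  proof -
    let ?f' = "\<lambda>t. - (1 / t\<^sup>2) * sin (x / t) - x / t ^ 3 * cos (x / t)"
    have "\<bar>(\<Sum>n | N \<le> real n \<and> n \<le> B. f (real n)) - integral {N..real B} (\<lambda>t. f t * dirichlet_kernel K t)\<bar>
        \<le> \<bar>f (real B)\<bar> + 12 * \<bar>f N\<bar> + real (B + 1) * (24 * (2 * x) / real k)"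
      unfolding K_def
    proof (rule sum_minus_integral_dirichlet_kernel)
      show "(f has_real_derivative ?f' t) (at t)" if "N \<le> t" for t
        unfolding f_def[abs_def] using that N by (intro sin_div_deriv) auto
      show "continuous_on {N..} ?f'" using N by (intro continuous_intros) auto
      show "\<bar>?f' t\<bar> \<le> 2 * x" if "N \<le> t" for t
        using that N x_ge by (intro abs_sin_div_deriv_le) auto
    qed (use k1 N B2 in auto)
    moreover have "\<bar>f t\<bar> \<le> 1 / N" if "N \<le> t" for t
    proof -
      have "\<bar>sin (x / t)\<bar> / t \<le> 1 / N" using that N by (intro frac_le) auto
      then show ?thesis using that N by (simp add: f_def abs_mult)
    qed
    from this[of N] this[of "real B"] have "\<bar>f N\<bar> \<le> 1 / N" "\<bar>f (real B)\<bar> \<le> 1 / N" using B2 N by auto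
    moreover have "real (B + 1) * (24 * (2 * x) / real k) \<le> 528 / N"
    proof -
      have "real (B + 1) * (24 * (2 * x) / real k) \<le> (11 * x\<^sup>2) * (24 * (2 * x) / x ^ 4)"
      proof (intro mult_mono divide_left_mono)
        show "real (B + 1) \<le> 11 * x\<^sup>2" using B xx x_ge by simp
        show "0 < real k * x ^ 4" using k1 x_ge by simp
      qed (use k x_ge in auto)
      also have "\<dots> = 528 / x" using x_ge by (simp add: field_simps eval_nat_numeral)
      also have "\<dots> \<le> 528 / N" using xN N by (intro divide_left_mono) auto
      finally show ?thesis .
    qed
    moreover have "541 / N = 1 / N + 12 * (1 / N) + 528 / N" by (simp add: add_divide_distrib[symmetric])
    ultimately show ?thesis by linarith
  qed

  have 3: "\<bar>integral {N..real B} f - pi / 2\<bar> \<le> 9 / N"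
  proof -
    have "\<bar>integral {N..real B} f - pi / 2\<bar> \<le> 8 * N / x + x / real B"
      unfolding f_def[abs_def] using x_ge N B2 by (intro integral_sin_div_minus_pi_half_le) auto
    also have "8 * N / x \<le> 8 * N / N\<^sup>2"
      using xN2 N x_ge zero_le_power2[of N] by (intro divide_left_mono) auto
    also have "8 * N / N\<^sup>2 = 8 / N" using N by (simp add: power2_eq_square)
    also have "x / real B \<le> x / (x * N)"
    proof (rule divide_left_mono)
      have "x * N \<le> x * x" using xN N x_ge by (intro mult_left_mono) auto
      then show "x * N \<le> real B" using B(1) by (simp add: power2_eq_square)
    qed (use x_ge N B2 in auto)
    also have "8 / N + x / (x * N) = 9 / N" using x_ge by (simp add: add_divide_distrib[symmetric])
    finally show ?thesis by simp
  qed

  define P where "P m = integral {N..real B} (\<lambda>t. 1 / t * sin (x / t + 2 * pi * real m * t))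
      + integral {N..real B} (\<lambda>t. 1 / t * sin (x / t - 2 * pi * real m * t))" for m
  have 4: "integral {N..real B} (\<lambda>t. f t * dirichlet_kernel K t) = integral {N..real B} f + (\<Sum>m = 1..K. P m)"
    unfolding f_def[abs_def] P_def using N by (intro integral_dirichlet_kernel_sin_div) auto
  have 5: "\<bar>(\<Sum>m = 1..K. P m) - (\<Sum>m | 1 \<le> m \<and> real m < M. g m)\<bar> \<le> 165 * (ln x / N) + 10 / sqrt (M * N)"
  proof -
    have "(\<Sum>m | 1 \<le> m \<and> real m < M. g m) = (\<Sum>m = 1..K. if real m < M then g m else 0)"
    proof -
      have "{m. 1 \<le> m \<and> real m < M} = {m \<in> {1..K}. real m < M}" using K by auto
      then show ?thesis by (simp only: sum.inter_filter[OF finite_atLeastAtMost])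
    qed
    then have "\<bar>(\<Sum>m = 1..K. P m) - (\<Sum>m | 1 \<le> m \<and> real m < M. g m)\<bar>
        = \<bar>\<Sum>m = 1..K. P m - (if real m < M then g m else 0)\<bar>"
      by (simp only: sum_subtractf)
    also have "\<dots> \<le> (\<Sum>m = 1..K. \<bar>P m - (if real m < M then g m else 0)\<bar>)"
      by (rule sum_abs)
    also have "\<dots> \<le> (\<Sum>m = 1..K. 7 / (real m * N)
        + (if 1 \<le> \<bar>real m - M\<bar> then 2 / (N * \<bar>real m - M\<bar>) else 5 / sqrt (M * N)))"
    proof (rule sum_mono)
      fix m assume "m \<in> {1..K}"
      then show "\<bar>P m - (if real m < M then g m else 0)\<bar> \<le> 7 / (real m * N)
        + (if 1 \<le> \<bar>real m - M\<bar> then 2 / (N * \<bar>real m - M\<bar>) else 5 / sqrt (M * N))"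
        using phase_error_le[of m M N "real B", unfolded x_eq] M N B2 \<open>4 * x \<le> (real B)\<^sup>2\<close>
        unfolding P_def g_def by simp
    qed
    also have "\<dots> \<le> 15 * harm K / N + 10 / sqrt (M * N)"
      by (rule sum_phase_error_le[OF M K(2) N])
    also have "15 * harm K / N \<le> 15 * (11 * ln x) / N"
    \<comment> \<open>\<open>K = k\<^sup>2\<close> is at most \<open>4 * x ^ 8\<close>. Since
      \<open>6 \<le> x\<close>, both \<open>ln 2\<close> and 1 are below \<open>ln x\<close>, which
      gives 10 and then 11.\<close>
    proof (intro divide_right_mono mult_left_mono)
      have "ln (real k) \<le> ln (2 * x ^ 4)" by (intro ln_mono) (use k k1 in auto)
      also have "\<dots> = ln 2 + 4 * ln x" using x_ge by (simp add: ln_mult ln_realpow)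
      also have "ln 2 \<le> ln x" using x_ge by simp
      finally have "ln (real k) \<le> 5 * ln x" by simp
      then have "ln (real K) \<le> 10 * ln x" using k1 by (simp add: K_def ln_realpow)
      moreover have "1 \<le> ln x" using x_ge exp_le by (simp add: ln_ge_iff)
      ultimately show "harm K \<le> 11 * ln x" using harm_le_1_plus_ln[OF K(1)] by linarith
    qed (use N in auto)
    finally show ?thesis by simp
  qed

  have 6: "(\<Sum>n = 1..B. f (real n)) = (\<Sum>n | 1 \<le> n \<and> real n < N. f (real n)) + (\<Sum>n | N \<le> real n \<and> n \<le> B. f (real n))"
  proof -
    have "{1..B} = {n. 1 \<le> n \<and> real n < N} \<union> {n. N \<le> real n \<and> n \<le> B}"
      using N B2 by (auto simp: not_less)
    moreover have "finite {n. 1 \<le> n \<and> real n < N}"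
    proof (rule finite_subset)
      show "{n. 1 \<le> n \<and> real n < N} \<subseteq> {..B}" using B2 N by auto
    qed simp
    then have "sum (\<lambda>n. f (real n)) ({n. 1 \<le> n \<and> real n < N} \<union> {n. N \<le> real n \<and> n \<le> B})
        = (\<Sum>n | 1 \<le> n \<and> real n < N. f (real n)) + (\<Sum>n | N \<le> real n \<and> n \<le> B. f (real n))"
      by (intro sum.union_disjoint) auto
    ultimately show ?thesis by (simp only:)
  qed

  have "1 \<le> ln x" using x_ge exp_le by (simp add: ln_ge_iff)
  then have "1 / N + 541 / N + 9 / N \<le> 551 * (ln x / N)"
    using N by (simp add: add_divide_distrib[symmetric] divide_right_mono)
  \<comment> \<open>716 = 551 + 165, where 551 = 1 + 541 + 9 and 165 = 15 * 11. The combination is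
    stated for arbitrary reals to keep sums and integrals out of the linear arithmetic.\<close>
  moreover have "\<bar>Q - s - pi / 2 - G\<bar> \<le> 716 * u + v"
    if "\<bar>Q - T\<bar> \<le> e1" "\<bar>S - I\<bar> \<le> e2" "\<bar>I0 - pi / 2\<bar> \<le> e3" "I = I0 + Z" "\<bar>Z - G\<bar> \<le> 165 * u + v"
      "T = s + S" "e1 + e2 + e3 \<le> 551 * u" for Q s G u v T e1 S I e2 I0 e3 Z :: real
    using that by linarith
  from this[OF 1 2 3 4 5 6] calculation show ?thesis
    unfolding f_def g_def by blast
qed

theorem theorem2:
  shows "\<exists>C>0. \<forall>(M::real) (N::real) (x::real).
    1 \<le> M \<longrightarrow> 1 \<le> N \<longrightarrow> 2 * pi * M * N\<^sup>2 = x \<longrightarrow>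
      \<bar>HL_Q x
        - (\<Sum>n | 1 \<le> n \<and> real n < N. 1 / real n * sin (x / real n))
        - pi / 2
        - (\<Sum>m | 1 \<le> m \<and> real m < M.
             (pi / (2 * real m * x)) powr (1/4) * sin (pi / 4 + 2 * sqrt (2 * pi * real m * x)))\<bar>
      \<le> C * (ln x / N + x powr (-1/2) * N powr (1/2))"
proof (intro exI[of _ 716] conjI allI impI)
  fix M N x :: real
  assume M: "1 \<le> M" and N: "1 \<le> N" and x: "2 * pi * M * N\<^sup>2 = x"
  have x0: "0 < x" using M N by (simp flip: x)
  \<comment> \<open>By the relation between \<open>x\<close>, \<open>M\<close> and \<open>N\<close>,
    the second error term of the theorem equals \<open>1 / sqrt (2 * pi * M * N)\<close>.\<close>
  have "10 / sqrt (M * N) = 10 * sqrt (2 * pi) * (x powr (-1/2) * N powr (1/2))"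
  proof -
    have "x powr (-1/2) = 1 / sqrt x"
      using x0 powr_minus_divide[of x "1 / 2"] by (simp add: powr_half_sqrt)
    then have "x powr (-1/2) * N powr (1/2) = sqrt (N / x)"
      using N by (simp add: powr_half_sqrt real_sqrt_divide)
    also have "N / x = 1 / (2 * pi * (M * N))"
      using N by (simp flip: x add: power2_eq_square)
    also have "sqrt \<dots> = 1 / (sqrt (2 * pi) * sqrt (M * N))"
      by (simp only: real_sqrt_divide real_sqrt_mult real_sqrt_one)
    finally show ?thesis by simp
  qed
  also have "\<dots> \<le> 716 * (x powr (-1/2) * N powr (1/2))"
  proof (rule mult_right_mono)
    have "sqrt (2 * pi) \<le> 3" by (rule real_le_lsqrt) (use pi_less_4 in auto)
    then show "10 * sqrt (2 * pi) \<le> 716" by simp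
  qed simp
  finally show "\<bar>HL_Q x - (\<Sum>n | 1 \<le> n \<and> real n < N. 1 / real n * sin (x / real n)) - pi / 2
        - (\<Sum>m | 1 \<le> m \<and> real m < M.
             (pi / (2 * real m * x)) powr (1/4) * sin (pi / 4 + 2 * sqrt (2 * pi * real m * x)))\<bar>
      \<le> 716 * (ln x / N + x powr (-1/2) * N powr (1/2))"
    using HL_Q_approx[OF M N x] by (simp only: distrib_left)
qed simp

end
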